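(* Let $Z$ be a finite set of $d$ points in $\mathbb{P}^2=\mathbb{P}^2_{\mathbb{C}}$ with dual line arrangement $\mathcal{A}_Z:f_Z=0$, and assume that $$m(\mathcal{A}_Z)\leq mdr(f_Z)+\frac{3}{2}<\frac{d}{2}.$$ Let $m=m(\mathcal{A}_Z)$, let $p_{i_1},\ldots,p_{i_m}$ be a maximal set of collinear points in $Z$ (i.e. $m$ collinear points of $Z$, where $m$ is the maximal number of collinear points in $Z$), and let $L$ be the line in $\mathbb{P}^2$ determined by these points. Let $p'$ be a generic point on the line $L$ and consider the new set $Z'=Z\cup\{p'\}$. Then $Z'$ admits an unexpected curve of degree $j$, for any integer $j$ such that $$mdr(f_Z)+1<j\leq d-mdr(f_Z)-2.$$
   Context: Work over $\mathbb{C}$, $S=\mathbb{C}[x,y,z]$. "Generic point on $L$" means a point of a suitable nonempty Zariski open subset of $L$ (i.e. outside a finite subset of $L$); dually, the line dual to $p'$ is generic in the pencil of lines through the point dual to $L$. Unexpected curves: a finite set $Z\subset\mathbb{P}^2$ admits unexpected curves of degree $j\geq 2$ if, for a generic point $q\in\mathbb{P}^2$ (i.e. for $q$ in a nonempty Zariski open subset), $$h^0(\mathbb{P}^2,\mathcal{O}_{\mathbb{P}^2}(j)\otimes\mathcal{I}(Z+(j-1)q))>\max\left(0,\ h^0(\mathbb{P}^2,\mathcal{O}_{\mathbb{P}^2}(j)\otimes\mathcal{I}(Z))-\binom{j}{2}\right),$$ where $\mathcal{I}(Z)$ is the ideal sheaf of functions vanishing on $Z$ and $\mathcal{I}(Z+(j-1)q)$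 is the ideal sheaf of functions vanishing on $Z$ and vanishing to order $j-1$ at $q$. Dual arrangement: a point $(a:b:c)\in\mathbb{P}^2$ is dual to the line $ax+by+cz=0$; $\mathcal{A}_Z$ is the arrangement of the $d$ lines dual to the points of $Z$, and $f_Z\in S$ is the product of the corresponding linear forms. $m(\mathcal{A}_Z)$ is the maximal multiplicity of an intersection point of $\mathcal{A}_Z$ (equivalently, the maximal number of collinear points in $Z$), and $mdr(f)$ is the smallest integer $r\geq 0$ such that there is a nontrivial relation $af_x+bf_y+cf_z=0$ with $a,b,c\in S_r$ (homogeneous polynomials of degree $r$, not all zero). *)

theory Defs
  imports "HOL-Analysis.Analysis" "HOL-Library.Poly_Mapping"
begin

section \<open>The polynomial ring in three variables over the complex numbers\<close>

text \<open>The variables $x, y, z$ are indexed by the elements \<open>1, 2, 3\<close> of the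
  three-element type \<open>3\<close> (in which \<open>3 = 0\<close>), and a monomial is its exponent vector.\<close>

type_synonym monom3 = "3 \<Rightarrow>\<^sub>0 nat"
type_synonym poly3 = "monom3 \<Rightarrow>\<^sub>0 complex"

definition poly_scale :: "complex \<Rightarrow> poly3 \<Rightarrow> poly3" where
  "poly_scale c g = Poly_Mapping.single 0 c * g"

interpretation poly3: vector_space poly_scale
  by unfold_locales
    (simp_all add: poly_scale_def distrib_left distrib_right single_add
      mult_single mult.assoc[symmetric])

definition eval3 :: "poly3 \<Rightarrow> complex ^ 3 \<Rightarrow> complex" where
  "eval3 g v = (\<Sum>e\<in>Poly_Mapping.keys g.
      Poly_Mapping.lookup g e * (\<Prod>i\<in>UNIV. (v $ i) ^ Poly_Mapping.lookup e i))"

text \<open>If \<open>x\<^sub>i\<close> does not occur in the monomial \<open>e\<close>, the truncated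
  subtraction in the exponent is harmless because the coefficient is \<open>0\<close>.\<close>

definition partial :: "3 \<Rightarrow> poly3 \<Rightarrow> poly3" where
  "partial i g = (\<Sum>e\<in>Poly_Mapping.keys g.
      Poly_Mapping.single (e - Poly_Mapping.single i 1)
        (of_nat (Poly_Mapping.lookup e i) * Poly_Mapping.lookup g e))"

text \<open>The zero polynomial is homogeneous of every degree, so the polynomials that are
  homogeneous of degree \<open>r\<close> form the graded piece $S_r$.\<close>

definition homogeneous :: "nat \<Rightarrow> poly3 \<Rightarrow> bool" where
  "homogeneous r g \<longleftrightarrow>
    (\<forall>e\<in>Poly_Mapping.keys g. (\<Sum>i\<in>UNIV. Poly_Mapping.lookup e i) = r)"

definition linear_form :: "complex ^ 3 \<Rightarrow> poly3" where
  "linear_form v = (\<Sum>i\<in>UNIV. Poly_Mapping.single (Poly_Mapping.single i 1) (v $ i))"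

definition mdr :: "poly3 \<Rightarrow> nat" where
  "mdr f = (LEAST r. \<exists>a b c. homogeneous r a \<and> homogeneous r b \<and> homogeneous r c \<and>
      \<not> (a = 0 \<and> b = 0 \<and> c = 0) \<and>
      a * partial 1 f + b * partial 2 f + c * partial 3 f = 0)"

section \<open>The projective plane\<close>

definition proportional :: "complex ^ 3 \<Rightarrow> complex ^ 3 \<Rightarrow> bool" where
  "proportional u v \<longleftrightarrow> u \<noteq> 0 \<and> v \<noteq> 0 \<and> (\<exists>c. c \<noteq> 0 \<and> v = c *s u)"

text \<open>The morphism \<open>coords\<close> picks some homogeneous coordinate vector of a point. Below it is
  only used where the choice does not matter: for the vanishing of homogeneous polynomials,
  and for the defining polynomial of an arrangement, which is determined up to a
  nonzero constant factor.\<close>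

quotient_type proj_plane = "complex ^ 3" / partial: proportional
  morphisms coords point_of
proof (rule part_equivpI)
  show "\<exists>u. proportional u u"
    by (rule exI[of _ "axis 1 1"]) (auto simp: proportional_def axis_eq_0_iff intro: exI[of _ 1])
  show "symp proportional"
  proof (rule sympI)
    fix u v assume "proportional u v"
    then obtain c where "u \<noteq> 0" "v \<noteq> 0" "c \<noteq> 0" "v = c *s u"
      by (auto simp: proportional_def)
    then show "proportional v u"
      by (auto simp: proportional_def vector_smult_assoc intro!: exI[of _ "inverse c"])
  qed
  show "transp proportional"
  proof (rule transpI)
    fix u v w assume "proportional u v" "proportional v w"
    then obtain c c' where "u \<noteq> 0" "w \<noteq> 0" "c \<noteq> 0" "v = c *s u" "c' \<noteq> 0" "w = c' *s v"
      by (auto simp: proportional_def)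
    then show "proportional u w"
      by (auto simp: proportional_def vector_smult_assoc intro!: exI[of _ "c' * c"])
  qed
qed

definition vanishes_at :: "poly3 \<Rightarrow> proj_plane \<Rightarrow> bool" where
  "vanishes_at g p \<longleftrightarrow> eval3 g (coords p) = 0"

text \<open>A form vanishes to order at least \<open>k\<close> at a point if all its iterated partial
  derivatives of order less than \<open>k\<close> vanish there. By Euler's formula, taking the
  derivatives in the three homogeneous variables gives the same condition as taking them in
  two affine coordinates around the point.\<close>

definition vanishes_to_order :: "nat \<Rightarrow> poly3 \<Rightarrow> proj_plane \<Rightarrow> bool" where
  "vanishes_to_order k g p \<longleftrightarrow> (\<forall>is. length is < k \<longrightarrow> vanishes_at (fold partial is g) p)"

definition zariski_closed :: "proj_plane set \<Rightarrow> bool" where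
  "zariski_closed C \<longleftrightarrow>
    (\<exists>G. (\<forall>g\<in>G. \<exists>r. homogeneous r g) \<and> C = {p. \<forall>g\<in>G. vanishes_at g p})"

definition zariski_open :: "proj_plane set \<Rightarrow> bool" where
  "zariski_open U \<longleftrightarrow> zariski_closed (- U)"

text \<open>\<open>P\<close> holds at a generic point of \<open>X\<close>: it holds on a nonempty subset of \<open>X\<close> that is
  open in the Zariski topology induced on \<open>X\<close>. It is used for \<open>X\<close> the plane and for
  \<open>X\<close> a line, which are irreducible; on a line, this means outside a finite set.\<close>

definition generically_on :: "proj_plane set \<Rightarrow> (proj_plane \<Rightarrow> bool) \<Rightarrow> bool" where
  "generically_on X P \<longleftrightarrow> (\<exists>U. zariski_open U \<and> U \<inter> X \<noteq> {} \<and> (\<forall>p\<in>U \<inter> X. P p))"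

section \<open>Dual line arrangements\<close>

definition dual_line :: "proj_plane \<Rightarrow> proj_plane set" where
  "dual_line p = {q. vanishes_at (linear_form (coords p)) q}"

definition is_line :: "proj_plane set \<Rightarrow> bool" where
  "is_line L \<longleftrightarrow> (\<exists>p. L = dual_line p)"

definition dual_arrangement :: "proj_plane set \<Rightarrow> proj_plane set set" where
  "dual_arrangement Z = dual_line ` Z"

definition dual_poly :: "proj_plane set \<Rightarrow> poly3" where
  "dual_poly Z = (\<Prod>p\<in>Z. linear_form (coords p))"

definition multiplicity_at :: "proj_plane set set \<Rightarrow> proj_plane \<Rightarrow> nat" where
  "multiplicity_at A q = card {l \<in> A. q \<in> l}"

text \<open>The intersection points are the points lying on at least two lines of the
  arrangement; they exist as soon as there are at least two lines.\<close>

definition max_multiplicity :: "proj_plane set set \<Rightarrow> nat" where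
  "max_multiplicity A = Max {multiplicity_at A q | q. 2 \<le> multiplicity_at A q}"

section \<open>Unexpected curves\<close>

text \<open>The global sections of $\mathcal{O}(j)$ are the forms of degree \<open>j\<close>, and those of
  its twist by the ideal sheaf $\mathcal{I}(Z)$, respectively $\mathcal{I}(Z + k q)$, are the
  forms vanishing on \<open>Z\<close>, respectively the ones that moreover vanish to order \<open>k\<close> at \<open>q\<close>.\<close>

definition h0_ideal :: "nat \<Rightarrow> proj_plane set \<Rightarrow> nat" where
  "h0_ideal j Z = poly3.dim {g. homogeneous j g \<and> (\<forall>p\<in>Z. vanishes_at g p)}"

definition h0_ideal_fat :: "nat \<Rightarrow> proj_plane set \<Rightarrow> nat \<Rightarrow> proj_plane \<Rightarrow> nat" where
  "h0_ideal_fat j Z k q =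
    poly3.dim {g. homogeneous j g \<and> (\<forall>p\<in>Z. vanishes_at g p) \<and> vanishes_to_order k g q}"

definition admits_unexpected_curves :: "proj_plane set \<Rightarrow> nat \<Rightarrow> bool" where
  "admits_unexpected_curves Z j \<longleftrightarrow> 2 \<le> j \<and>
    generically_on UNIV (\<lambda>q.
      int (h0_ideal_fat j Z (j - 1) q) > max 0 (int (h0_ideal j Z) - int (j choose 2)))"

end

(* A Jacobian relation of degree r is a polynomial vector field theta that annihilates f_Z, hence is
   tangent to every line dual to a point of Z. With . the bilinear pairing and x the cross product, the
   form P . theta(P x q) in P therefore vanishes on Z; it has degree r + 1 and order r at q. It is
   nonzero for generic q, since otherwise theta would be a multiple of the Euler field, which does
   not annihilate f_Z. Multiplied by the line through p' and q and by j - r - 2 further lines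
   through q, these forms span a space of dimension at least j - r - 1 of curves of degree j with a
   point of multiplicity j - 1 at q. On the other hand at most r + 2 <= j points of Z' are collinear.
   Then any j + r + 3 <= 2j + 1 of them impose independent conditions on forms of degree j, because
   a point is separated from the others by a product of j lines covering two others each. So the
   expected dimension is at most 2j + 1 - (j + r + 3) = j - r - 2. *)
theory Submission
  imports Defs "HOL-Computational_Algebra.Polynomial"
begin

section \<open>Evaluation and partial derivatives\<close>

abbreviation monom_eval :: "monom3 \<Rightarrow> complex ^ 3 \<Rightarrow> complex" where
  "monom_eval e v \<equiv> \<Prod>i\<in>UNIV. (v $ i) ^ Poly_Mapping.lookup e i"

text \<open>Evaluation and differentiation are additive, so this induction reduces the product
  formulas for them to single terms.\<close>

lemma poly3_induct [case_names single add]: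
  fixes g :: poly3
  assumes single: "\<And>e c. P (Poly_Mapping.single e c)"
    and add: "\<And>f g. P f \<Longrightarrow> P g \<Longrightarrow> P (f + g)"
  shows "P g"
proof -
  have decomp: "g = (\<Sum>e\<in>Poly_Mapping.keys g.
      Poly_Mapping.single e (Poly_Mapping.lookup g e))"
    by (rule poly_mapping_eqI)
      (simp add: lookup_sum lookup_single when_def in_keys_iff)
  have "P (\<Sum>e\<in>A. Poly_Mapping.single e (Poly_Mapping.lookup g e))" if "finite A" for A
    using that
  proof induction
    case empty
    \<comment> \<open>The empty sum is the term with exponent 0 and coefficient 0.\<close>
    then show ?case using single[of 0 0] by simp
  qed (simp add: add single)
  then show ?thesis by (subst decomp) simp
qed

text \<open>Over a common index set containing both supports, additivity becomes a termwise identity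
  even when terms of \<open>f + g\<close> cancel.\<close>

lemma eval3_superset:
  assumes "finite A" "Poly_Mapping.keys g \<subseteq> A"
  shows "eval3 g v = (\<Sum>e\<in>A. Poly_Mapping.lookup g e * monom_eval e v)"
  unfolding eval3_def using assms
  by (intro sum.mono_neutral_left) (auto simp: in_keys_iff)

lemma eval3_single [simp]: "eval3 (Poly_Mapping.single e c) v = c * monom_eval e v"
  by (simp add: eval3_superset[of "{e}"])

lemma eval3_0 [simp]: "eval3 0 v = 0"
  by (simp add: eval3_def)

lemma eval3_1 [simp]: "eval3 1 v = 1"
  using eval3_single[of 0 1 v] by simp

lemma eval3_add [simp]: "eval3 (f + g) v = eval3 f v + eval3 g v"
proof -
  let ?A = "Poly_Mapping.keys f \<union> Poly_Mapping.keys g"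
  have "Poly_Mapping.keys (f + g) \<subseteq> ?A" by (rule keys_add)
  then show ?thesis
    by (simp add: eval3_superset[of ?A] lookup_add distrib_right sum.distrib)
qed

lemma eval3_mult [simp]: "eval3 (f * g) v = eval3 f v * eval3 g v"
proof (induction f rule: poly3_induct)
  case (single e c)
  show ?case
    by (induction g rule: poly3_induct)
      (simp_all add: mult_single lookup_add power_add prod.distrib distrib_left)
qed (simp add: distrib_right)

lemma eval3_sum [simp]: "eval3 (\<Sum>x\<in>A. g x) v = (\<Sum>x\<in>A. eval3 (g x) v)"
  by (induction A rule: infinite_finite_induct) simp_all

lemma eval3_prod [simp]: "eval3 (\<Prod>x\<in>A. g x) v = (\<Prod>x\<in>A. eval3 (g x) v)"
  by (induction A rule: infinite_finite_induct) simp_all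

lemma eval3_scale [simp]: "eval3 (poly_scale c g) v = c * eval3 g v"
  by (simp add: poly_scale_def)

section \<open>Formal partial derivatives\<close>

lemma partial_superset:
  assumes "finite A" "Poly_Mapping.keys g \<subseteq> A"
  shows "partial i g = (\<Sum>e\<in>A. Poly_Mapping.single (e - Poly_Mapping.single i 1)
      (of_nat (Poly_Mapping.lookup e i) * Poly_Mapping.lookup g e))"
  unfolding partial_def using assms
  by (intro sum.mono_neutral_left) (auto simp: in_keys_iff)

lemma partial_single [simp]:
  "partial i (Poly_Mapping.single e c) =
    Poly_Mapping.single (e - Poly_Mapping.single i 1) (of_nat (Poly_Mapping.lookup e i) * c)"
  by (simp add: partial_superset[of "{e}"])

lemma partial_0 [simp]: "partial i 0 = 0"
  by (simp add: partial_def)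

lemma partial_1 [simp]: "partial i 1 = 0"
  using partial_single[of i 0 1] by simp

lemma partial_add [simp]: "partial i (f + g) = partial i f + partial i g"
proof -
  let ?A = "Poly_Mapping.keys f \<union> Poly_Mapping.keys g"
  have "Poly_Mapping.keys (f + g) \<subseteq> ?A" by (rule keys_add)
  then show ?thesis
    by (simp add: partial_superset[of ?A] lookup_add distrib_left single_add sum.distrib)
qed

text \<open>Truncated subtraction of exponents commutes with addition when the variable divides the
  monomial. In the Leibniz rule the remaining terms have coefficient 0.\<close>

lemma single_minus_add:
  fixes e :: monom3
  assumes "Poly_Mapping.lookup e i \<noteq> 0"
  shows "e - Poly_Mapping.single i 1 + e' = e + e' - Poly_Mapping.single i 1"
  using assms
  by (intro poly_mapping_eqI) (auto simp: lookup_add lookup_minus lookup_single when_def)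

lemma partial_mult: "partial i (f * g) = partial i f * g + f * partial i g"
proof (induction f rule: poly3_induct)
  case (single e c)
  show ?case
  proof (induction g rule: poly3_induct)
    case (single e' c')
    have 1: "Poly_Mapping.single (e - Poly_Mapping.single i 1 + e')
          (of_nat (Poly_Mapping.lookup e i) * c * c') =
        Poly_Mapping.single (e + e' - Poly_Mapping.single i 1)
          (of_nat (Poly_Mapping.lookup e i) * c * c')"
      using single_minus_add[of e i e'] by (cases "Poly_Mapping.lookup e i = 0") simp_all
    have 2: "Poly_Mapping.single (e + (e' - Poly_Mapping.single i 1))
          (c * (of_nat (Poly_Mapping.lookup e' i) * c')) =
        Poly_Mapping.single (e + e' - Poly_Mapping.single i 1)
          (c * (of_nat (Poly_Mapping.lookup e' i) * c'))"
      using single_minus_add[of e' i e]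
      by (cases "Poly_Mapping.lookup e' i = 0") (simp_all add: add.commute)
    show ?case
      by (simp add: mult_single 1[simplified] 2[simplified] lookup_add single_add[symmetric])
        (simp add: algebra_simps)
  qed (simp add: algebra_simps)
qed (simp add: algebra_simps)

lemma partial_sum [simp]: "partial i (\<Sum>x\<in>A. g x) = (\<Sum>x\<in>A. partial i (g x))"
  by (induction A rule: infinite_finite_induct) simp_all

lemma monom_eval_single [simp]: "monom_eval (Poly_Mapping.single i 1) v = v $ i"
proof -
  have "monom_eval (Poly_Mapping.single i 1) v = (\<Prod>k\<in>UNIV. if k = i then v $ k else 1)"
    by (rule prod.cong) (auto simp: lookup_single when_def)
  then show ?thesis by simp
qed

text \<open>Bilinear rather than Hermitian: it is the incidence form between points and lines, and
  the value of a linear form.\<close>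

definition pairing :: "complex ^ 3 \<Rightarrow> complex ^ 3 \<Rightarrow> complex" where
  "pairing u v = (\<Sum>i\<in>UNIV. u $ i * v $ i)"

lemma pairing_commute: "pairing u v = pairing v u"
  by (simp add: pairing_def mult.commute)

lemma pairing_simps [simp]:
  "pairing u (c *s v) = c * pairing u v" "pairing (c *s u) v = c * pairing u v"
  "pairing u 0 = 0" "pairing 0 u = 0"
  "pairing u (v + w) = pairing u v + pairing u w"
  "pairing u (v - w) = pairing u v - pairing u w"
  by (simp_all add: pairing_def sum_distrib_left sum.distrib sum_subtractf algebra_simps)

lemma pairing_axis [simp]: "pairing u (axis i 1) = u $ i" "pairing (axis i 1) u = u $ i"
  by (simp_all add: pairing_def axis_def if_distrib if_distribR cong: if_cong)

lemma eval3_linear_form [simp]: "eval3 (linear_form v) w = pairing v w"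
  by (simp add: linear_form_def pairing_def del: One_nat_def)

lemma partial_linear_form: "partial i (linear_form v) = Poly_Mapping.single 0 (v $ i)"
proof -
  have "partial i (linear_form v) =
      (\<Sum>k\<in>UNIV. if k = i then Poly_Mapping.single 0 (v $ k) else 0)"
    unfolding linear_form_def partial_sum
    by (rule sum.cong) (auto simp: lookup_single when_def)
  then show ?thesis by simp
qed

lemma eval3_partial_prod:
  assumes "finite A"
  shows "eval3 (partial i (\<Prod>z\<in>A. linear_form (c z))) w =
    (\<Sum>z\<in>A. c z $ i * (\<Prod>z'\<in>A - {z}. pairing (c z') w))"
  using assms
proof induction
  case (insert x F)
  have "(\<Prod>z'\<in>insert x F - {z}. pairing (c z') w) =
      pairing (c x) w * (\<Prod>z'\<in>F - {z}. pairing (c z') w)" if "z \<in> F" for z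
  proof -
    have "insert x F - {z} = insert x (F - {z})" using that insert by auto
    then show ?thesis using insert by simp
  qed
  moreover have "insert x F - {x} = F" using insert by auto
  ultimately show ?case
    using insert
    by (simp add: partial_mult partial_linear_form sum_distrib_left mult_ac
        cong: sum.cong)
qed simp

section \<open>Homogeneous polynomials\<close>

lemma homogeneous_single:
  "(\<Sum>i\<in>UNIV. Poly_Mapping.lookup e i) = r \<Longrightarrow> homogeneous r (Poly_Mapping.single e c)"
  by (simp add: homogeneous_def)

lemma homogeneous_0 [simp]: "homogeneous r 0"
  by (simp add: homogeneous_def)

lemma homogeneous_const: "homogeneous 0 (Poly_Mapping.single 0 c)"
  by (rule homogeneous_single) simp

lemma homogeneous_1 [simp]: "homogeneous 0 1"
  using homogeneous_const[of 1] by simp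

lemma homogeneous_add: "homogeneous r f \<Longrightarrow> homogeneous r g \<Longrightarrow> homogeneous r (f + g)"
  using keys_add[of f g] unfolding homogeneous_def by blast

lemma homogeneous_mult:
  assumes "homogeneous r f" "homogeneous s g"
  shows "homogeneous (r + s) (f * g)"
  unfolding homogeneous_def
proof
  fix e assume "e \<in> Poly_Mapping.keys (f * g)"
  then obtain a b where "a \<in> Poly_Mapping.keys f" "b \<in> Poly_Mapping.keys g" "e = a + b"
    using keys_mult[of f g] by blast
  then show "(\<Sum>i\<in>UNIV. Poly_Mapping.lookup e i) = r + s"
    using assms by (simp add: homogeneous_def lookup_add sum.distrib)
qed

lemma homogeneous_scale: "homogeneous r g \<Longrightarrow> homogeneous r (poly_scale c g)"
  using homogeneous_mult[OF homogeneous_const] by (simp add: poly_scale_def)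

lemma homogeneous_sum: "(\<And>x. x \<in> A \<Longrightarrow> homogeneous r (g x)) \<Longrightarrow> homogeneous r (\<Sum>x\<in>A. g x)"
  by (induction A rule: infinite_finite_induct) (simp_all add: homogeneous_add)

lemma homogeneous_prod:
  "(\<And>x. x \<in> A \<Longrightarrow> homogeneous (r x) (g x)) \<Longrightarrow> homogeneous (\<Sum>x\<in>A. r x) (\<Prod>x\<in>A. g x)"
  by (induction A rule: infinite_finite_induct) (simp_all add: homogeneous_mult)

lemma homogeneous_linear_form [simp]: "homogeneous (Suc 0) (linear_form v)"
  unfolding linear_form_def
  by (intro homogeneous_sum homogeneous_single) (simp add: lookup_single when_def)

lemma homogeneous_prod_linear_form:
  "homogeneous (card A) (\<Prod>x\<in>A. linear_form (c x))"
  using homogeneous_prod[of A "\<lambda>_. 1" "\<lambda>x. linear_form (c x)"] by simp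

lemma homogeneous_partial:
  assumes "homogeneous r g"
  shows "homogeneous (r - 1) (partial i g)"
  unfolding partial_def
proof (rule homogeneous_sum)
  fix e assume e: "e \<in> Poly_Mapping.keys g"
  let ?t = "Poly_Mapping.single (e - Poly_Mapping.single i 1)
      (of_nat (Poly_Mapping.lookup e i) * Poly_Mapping.lookup g e)"
  show "homogeneous (r - 1) ?t"
  \<comment> \<open>If the exponent is 0, the term is the zero polynomial, homogeneous of every
    degree; this includes the case \<open>r = 0\<close>.\<close>
  proof (cases "Poly_Mapping.lookup e i = 0")
    case False
    have "(\<Sum>k\<in>UNIV. Poly_Mapping.lookup (e - Poly_Mapping.single i 1) k) +
        (\<Sum>k\<in>UNIV. Poly_Mapping.lookup (Poly_Mapping.single i (1::nat)) k) =
        (\<Sum>k\<in>UNIV. Poly_Mapping.lookup e k)"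
      using False unfolding sum.distrib[symmetric]
      by (intro sum.cong) (auto simp: lookup_minus lookup_single when_def)
    moreover have "(\<Sum>k\<in>UNIV. Poly_Mapping.lookup (Poly_Mapping.single i (1::nat)) k) = 1"
      by (simp add: lookup_single when_def)
    ultimately show ?thesis
      using assms e by (intro homogeneous_single) (auto simp: homogeneous_def)
  qed simp
qed

lemma eval3_homogeneous:
  assumes "homogeneous r g"
  shows "eval3 g (c *s v) = c ^ r * eval3 g v"
proof -
  have "monom_eval e (c *s v) = c ^ r * monom_eval e v" if "e \<in> Poly_Mapping.keys g" for e
  proof -
    have "monom_eval e (c *s v) = (\<Prod>i\<in>UNIV. c ^ Poly_Mapping.lookup e i) * monom_eval e v"
      by (simp add: power_mult_distrib prod.distrib)
    moreover have "(\<Prod>i\<in>UNIV. c ^ Poly_Mapping.lookup e i) = c ^ r"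
      using assms that unfolding homogeneous_def by (metis power_sum)
    ultimately show ?thesis by simp
  qed
  then show ?thesis
    unfolding eval3_def sum_distrib_left by (intro sum.cong) (auto simp: mult_ac)
qed

text \<open>Composition with three polynomials, by which the components of \<theta>(P x q) become
  forms in P, or in q.\<close>

definition subst_poly :: "poly3 \<Rightarrow> (3 \<Rightarrow> poly3) \<Rightarrow> poly3" where
  "subst_poly g R = (\<Sum>e\<in>Poly_Mapping.keys g.
      poly_scale (Poly_Mapping.lookup g e) (\<Prod>i\<in>UNIV. R i ^ Poly_Mapping.lookup e i))"

lemma eval3_power [simp]: "eval3 (g ^ n) v = eval3 g v ^ n"
  by (induction n) simp_all

lemma eval3_subst: "eval3 (subst_poly g R) v = eval3 g (\<chi> i. eval3 (R i) v)"
  by (simp add: subst_poly_def eval3_def[of g])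

lemma homogeneous_power: "homogeneous r g \<Longrightarrow> homogeneous (n * r) (g ^ n)"
  by (induction n) (simp_all add: homogeneous_mult)

lemma homogeneous_subst:
  assumes "homogeneous r g" and "\<And>i. homogeneous 1 (R i)"
  shows "homogeneous r (subst_poly g R)"
  unfolding subst_poly_def
proof (intro homogeneous_sum homogeneous_scale)
  fix e assume "e \<in> Poly_Mapping.keys g"
  moreover have "homogeneous (\<Sum>i\<in>UNIV. Poly_Mapping.lookup e i)
      (\<Prod>i\<in>UNIV. R i ^ Poly_Mapping.lookup e i)"
    by (rule homogeneous_prod) (use homogeneous_power[OF assms(2)] in auto)
  ultimately show "homogeneous r (\<Prod>i\<in>UNIV. R i ^ Poly_Mapping.lookup e i)"
    using assms(1) by (auto simp: homogeneous_def)
qed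

section \<open>Polynomial functions and genericity\<close>

text \<open>Each coordinate of a point moving on a line has degree at most 1 in the parameter, so
  questions of nonvanishing reduce to one variable.\<close>

lemma restrict_to_line:
  obtains p :: "complex poly" where "\<And>t. poly p t = eval3 g (v + t *s w)"
proof -
  have "\<exists>p :: complex poly. \<forall>t. poly p t = eval3 g (v + t *s w)"
  proof (induction g rule: poly3_induct)
    case (single e c)
    show ?case
      by (rule exI[of _ "smult c (\<Prod>i\<in>UNIV. [:v $ i, w $ i:] ^ Poly_Mapping.lookup e i)"])
        (simp add: poly_prod)
  next
    case (add f g)
    then obtain p q :: "complex poly" where
      "\<forall>t. poly p t = eval3 f (v + t *s w)" "\<forall>t. poly q t = eval3 g (v + t *s w)"
      by blast
    then show ?case by (intro exI[of _ "p + q"]) simp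
  qed
  then show thesis using that by blast
qed

text \<open>Closure under joining lines treats the whole space and the zero planes of linear forms
  together in the genericity arguments below.\<close>

definition affine_closed :: "(complex ^ 3) set \<Rightarrow> bool" where
  "affine_closed S \<longleftrightarrow> (\<forall>v\<in>S. \<forall>w\<in>S. \<forall>t. v + t *s (w - v) \<in> S)"

lemma affine_closed_UNIV: "affine_closed UNIV"
  by (simp add: affine_closed_def)

lemma affine_closed_orthogonal: "affine_closed {w. pairing u w = 0}"
  by (simp add: affine_closed_def)

text \<open>On the line joining \<open>v\<close> and \<open>w\<close> the two restrictions are
  nonzero univariate polynomials, and so is their product, which cannot vanish at every complex
  number. This plays the role of irreducibility of \<open>S\<close>.\<close>

lemma common_nonzero:
  assumes S: "affine_closed S"
    and g: "v \<in> S" "eval3 g v \<noteq> 0" and h: "w \<in> S" "eval3 h w \<noteq> 0"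
  shows "\<exists>u\<in>S. eval3 g u \<noteq> 0 \<and> eval3 h u \<noteq> 0"
proof -
  obtain p where p: "\<And>t. poly p t = eval3 g (v + t *s (w - v))"
    using restrict_to_line by blast
  obtain q where q: "\<And>t. poly q t = eval3 h (v + t *s (w - v))"
    using restrict_to_line by blast
  have "poly p 0 \<noteq> 0" "poly q 1 \<noteq> 0" using p q g h by simp_all
  then have "p * q \<noteq> 0" by auto
  then obtain t where "poly (p * q) t \<noteq> 0"
    using poly_all_0_iff_0 by blast
  then show ?thesis
    using S g(1) h(1) p q by (auto simp: affine_closed_def)
qed

lemma common_nonzero_finite:
  assumes S: "affine_closed S" and "finite A" and "S \<noteq> {}"
    and "\<And>a. a \<in> A \<Longrightarrow> \<exists>v\<in>S. eval3 (g a) v \<noteq> 0"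
  shows "\<exists>u\<in>S. \<forall>a\<in>A. eval3 (g a) u \<noteq> 0"
  using assms(2,4)
proof induction
  case empty
  then show ?case using assms(3) by auto
next
  case (insert a A)
  obtain v where "v \<in> S" "eval3 (g a) v \<noteq> 0" using insert.prems by blast
  moreover obtain w where "w \<in> S" "\<forall>b\<in>A. eval3 (g b) w \<noteq> 0"
    using insert.IH insert.prems by blast
  ultimately show ?case
    using common_nonzero[OF S, of v "g a" w "\<Prod>b\<in>A. g b"] insert.hyps(1) by auto
qed

text \<open>Kronecker substitution: \<open>(t, t\<^sup>N, t\<^bsup>N\<^sup>2\<^esup>)\<close> separates the monomials with
  exponents less than \<open>N\<close>.\<close>

lemma kronecker_inj:
  fixes a b c a' b' c' N :: nat
  assumes "a + N * b + N * N * c = a' + N * b' + N * N * c'"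
    and "a < N" "b < N" "a' < N" "b' < N"
  shows "a = a' \<and> b = b' \<and> c = c'"
proof -
  have "a + N * (b + N * c) = a' + N * (b' + N * c')"
    using assms(1) by (simp add: algebra_simps)
  then have "(a + N * (b + N * c)) mod N = (a' + N * (b' + N * c')) mod N"
    "(a + N * (b + N * c)) div N = (a' + N * (b' + N * c')) div N" by simp_all
  then have 1: "a = a'" "b + N * c = b' + N * c'" using assms(2-) by simp_all
  have "(b + N * c) mod N = (b' + N * c') mod N"
    "(b + N * c) div N = (b' + N * c') div N" by (simp_all only: 1(2))
  then show ?thesis using 1(1) assms(2-) by simp
qed

text \<open>With \<open>N\<close> above all exponents, the Kronecker substitution sends distinct
  monomials of \<open>g\<close> to distinct powers of t. No cancellation occurs, so a nonzero
  univariate polynomial results, and some t is not a root.\<close>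

lemma eval3_nonzero:
  assumes "g \<noteq> 0"
  obtains v where "eval3 g v \<noteq> 0"
proof -
  obtain e0 where e0: "Poly_Mapping.lookup g e0 \<noteq> 0"
    using assms by (metis poly_mapping_eqI lookup_zero)
  define E where "E = (\<Union>e\<in>Poly_Mapping.keys g. range (Poly_Mapping.lookup e))"
  define N where "N = Suc (Max E)"
  have "finite E" by (simp add: E_def)
  then have bound: "Poly_Mapping.lookup e i < N" if "e \<in> Poly_Mapping.keys g" for e i
    using that unfolding N_def less_Suc_eq_le by (intro Max_ge) (auto simp: E_def)
  define \<phi> where "\<phi> e = Poly_Mapping.lookup e 1 + N * Poly_Mapping.lookup e 2
      + N * N * Poly_Mapping.lookup e 3" for e :: monom3
  have inj: "e = e'" if e: "e \<in> Poly_Mapping.keys g" and e': "e' \<in> Poly_Mapping.keys g"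
    and eq: "\<phi> e = \<phi> e'" for e e'
  proof (rule poly_mapping_eqI)
    fix i
    show "Poly_Mapping.lookup e i = Poly_Mapping.lookup e' i"
      using kronecker_inj[OF eq[unfolded \<phi>_def] bound[OF e] bound[OF e] bound[OF e'] bound[OF e']]
        exhaust_3[of i] by auto
  qed
  define p where "p = (\<Sum>e\<in>Poly_Mapping.keys g. monom (Poly_Mapping.lookup g e) (\<phi> e))"
  have e0': "e0 \<in> Poly_Mapping.keys g" using e0 by (simp add: in_keys_iff)
  have "coeff p (\<phi> e0) = (\<Sum>e\<in>Poly_Mapping.keys g. if e = e0 then Poly_Mapping.lookup g e else 0)"
    unfolding p_def coeff_sum using inj e0' by (intro sum.cong) auto
  also have "\<dots> = Poly_Mapping.lookup g e0" using e0' by simp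
  finally have "p \<noteq> 0" using e0 by auto
  then obtain t where t: "poly p t \<noteq> 0" using poly_all_0_iff_0 by blast
  let ?v = "vector [t, t ^ N, t ^ (N * N)] :: complex ^ 3"
  have "monom_eval e ?v = t ^ \<phi> e" for e
    unfolding \<phi>_def power_add power_mult UNIV_3 by simp
  then have "poly p t = eval3 g ?v"
    by (simp add: p_def poly_sum poly_monom eval3_def)
  then show thesis using that t by metis
qed

section \<open>The cross product\<close>

text \<open>Gives the coordinates of the line through two points and, dually, of the common point of
  two lines. Together with \<open>pairing\<close> it forms the 3 x 3 determinant.\<close>

definition cross :: "complex ^ 3 \<Rightarrow> complex ^ 3 \<Rightarrow> complex ^ 3" where
  "cross u v = vector [u $ 2 * v $ 3 - u $ 3 * v $ 2, u $ 3 * v $ 1 - u $ 1 * v $ 3,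
    u $ 1 * v $ 2 - u $ 2 * v $ 1]"

lemma cross_components [simp]:
  "cross u v $ 1 = u $ 2 * v $ 3 - u $ 3 * v $ 2"
  "cross u v $ 2 = u $ 3 * v $ 1 - u $ 1 * v $ 3"
  "cross u v $ 3 = u $ 1 * v $ 2 - u $ 2 * v $ 1"
  by (simp_all add: cross_def)

lemma pairing_3: "pairing u v = u $ 1 * v $ 1 + u $ 2 * v $ 2 + u $ 3 * v $ 3"
  by (simp add: pairing_def sum_3)

lemma pairing_cross [simp]:
  "pairing u (cross u v) = 0" "pairing v (cross u v) = 0"
  "pairing (cross u v) u = 0" "pairing (cross u v) v = 0"
  by (simp_all add: pairing_3 algebra_simps)

lemma pairing_cross_rotate: "pairing (cross u v) w = pairing u (cross v w)"
  by (simp add: pairing_3 algebra_simps)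

text \<open>The Binet-Cauchy identity.\<close>

lemma pairing_cross_cross:
  "pairing (cross a b) (cross c d) = pairing a c * pairing b d - pairing a d * pairing b c"
  by (simp add: pairing_3 algebra_simps)

text \<open>The scalar is the determinant of w, a, b. The identity lets a prescribed vector be
  written, up to a factor, as a cross product P x q.\<close>

lemma cross_cross_common: "cross (cross w a) (cross w b) = pairing (cross w a) b *s w"
  by (simp add: vec_eq_iff forall_3 pairing_3 algebra_simps)

lemma exists_pairing_nonzero:
  assumes "u \<noteq> 0"
  obtains v where "pairing u v \<noteq> 0"
  using assms that[of "axis _ 1"] by (auto simp: vec_eq_iff)

lemma cross_eq_0:
  assumes "cross u v = 0" "u \<noteq> 0"
  obtains c where "v = c *s u"
proof -
  obtain i where i: "u $ i \<noteq> 0" using assms(2) by (auto simp: vec_eq_iff)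
  have "cross u v $ 1 = 0" "cross u v $ 2 = 0" "cross u v $ 3 = 0" using assms(1) by simp_all
  then have "v = (v $ i / u $ i) *s u"
    using i exhaust_3[of i] by (auto simp: vec_eq_iff forall_3 field_simps)
  then show thesis using that by blast
qed

section \<open>Points and lines\<close>

lemma coords_nonzero [simp]: "coords p \<noteq> 0"
proof -
  have "proportional (coords p) (coords p)"
    using Quotient3_rel_rep[OF Quotient3_proj_plane] by blast
  then show ?thesis by (simp add: proportional_def)
qed

lemma proportional_refl: "v \<noteq> 0 \<Longrightarrow> proportional v v"
  by (auto simp: proportional_def intro: exI[of _ 1])

lemma coords_point_of:
  assumes "v \<noteq> 0"
  obtains c where "c \<noteq> 0" "coords (point_of v) = c *s v"
proof -
  have "proportional (coords (point_of v)) v"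
    using Quotient3_rep_abs[OF Quotient3_proj_plane] proportional_refl[OF assms] by blast
  then obtain c where "c \<noteq> 0" "v = c *s coords (point_of v)" by (auto simp: proportional_def)
  then show thesis
    using that[of "inverse c"] by (metis nonzero_imp_inverse_nonzero vector_smult_assoc left_inverse vector_smult_lid)
qed

lemma point_eqI:
  assumes "coords q = c *s coords p"
  shows "p = q"
proof -
  have "c \<noteq> 0" using assms coords_nonzero[of q] by auto
  then have "proportional (coords p) (coords q)" using assms by (auto simp: proportional_def)
  then show ?thesis
    using Quotient3_rel_rep[OF Quotient3_proj_plane] by blast
qed

lemma cross_coords_nonzero:
  assumes "p \<noteq> q"
  shows "cross (coords p) (coords q) \<noteq> 0"
  using assms by (metis cross_eq_0 coords_nonzero point_eqI)

lemma vanishes_at_point_of: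
  assumes "homogeneous r g" "v \<noteq> 0"
  shows "vanishes_at g (point_of v) \<longleftrightarrow> eval3 g v = 0"
proof -
  obtain c where "c \<noteq> 0" "coords (point_of v) = c *s v" using coords_point_of[OF assms(2)] .
  then show ?thesis using assms(1) by (simp add: vanishes_at_def eval3_homogeneous)
qed

lemma mem_dual_line: "q \<in> dual_line p \<longleftrightarrow> pairing (coords p) (coords q) = 0"
  by (simp add: dual_line_def vanishes_at_def)

lemma mem_dual_line_commute: "q \<in> dual_line p \<longleftrightarrow> p \<in> dual_line q"
  by (simp add: mem_dual_line pairing_commute)

text \<open>For p and q distinct, a vector p x a with nonzero determinant of q, p, a lies on the
  first line and off the second. Injectivity turns counting lines of the arrangement into counting
  points of \<open>Z\<close>.\<close>

lemma inj_dual_line: "inj dual_line"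
proof
  fix p q assume eq: "dual_line p = dual_line q"
  show "p = q"
  proof (rule ccontr)
    assume "p \<noteq> q"
    then obtain a where a: "pairing (cross (coords q) (coords p)) a \<noteq> 0"
      using cross_coords_nonzero exists_pairing_nonzero by metis
    define v where "v = cross (coords p) a"
    have v: "pairing (coords q) v \<noteq> 0" using a by (simp add: v_def pairing_cross_rotate)
    then have "v \<noteq> 0" by auto
    then obtain c where "c \<noteq> 0" "coords (point_of v) = c *s v" using coords_point_of by blast
    then have "point_of v \<in> dual_line p" "point_of v \<notin> dual_line q"
      using v by (simp_all add: mem_dual_line) (simp add: v_def)
    then show False using eq by simp
  qed
qed

text \<open>By duality the lines of the arrangement through \<open>q\<close> correspond to the
  points of \<open>Z\<close> on \<open>dual_line q\<close>. The lower bound 2 is there because the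
  maximum ranges over genuine intersection points.\<close>

lemma card_dual_line_le_max_multiplicity:
  assumes "finite Z" and "2 \<le> card (Z \<inter> dual_line q)"
  shows "card (Z \<inter> dual_line q) \<le> max_multiplicity (dual_arrangement Z)"
proof -
  let ?M = "{multiplicity_at (dual_arrangement Z) q | q. 2 \<le> multiplicity_at (dual_arrangement Z) q}"
  have mult: "multiplicity_at (dual_arrangement Z) q = card (Z \<inter> dual_line q)" for q
  proof -
    have "{l \<in> dual_arrangement Z. q \<in> l} = dual_line ` (Z \<inter> dual_line q)"
      using mem_dual_line_commute by (auto simp: dual_arrangement_def)
    then show ?thesis
      unfolding multiplicity_at_def using inj_dual_line
      by (metis card_image inj_on_subset subset_UNIV)
  qed
  \<comment> \<open>\<open>Max\<close> is meaningful only for a finite set of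
    multiplicities.\<close>
  have "?M \<subseteq> {..card Z}" using assms(1) by (auto simp: mult intro: card_mono)
  then have "finite ?M" by (rule finite_subset) simp
  then show ?thesis
    unfolding max_multiplicity_def using assms(2) by (intro Max_ge) (auto simp: mult)
qed

section \<open>The line through two points\<close>

lemma cross_cross: "cross u (cross v w) = pairing u w *s v - pairing u v *s w"
  unfolding vec_eq_iff forall_3 cross_components pairing_3 vector_minus_component
    vector_smult_component
  by (intro conjI; algebra)

text \<open>Expanding the triple product gives q x (p x x) = 0 when both points are on the line, so
  p x x is parallel to its coordinate vector.\<close>

lemma coords_eq_cross:
  assumes "p \<noteq> x" "p \<in> dual_line q" "x \<in> dual_line q"
  obtains c where "c \<noteq> 0" "cross (coords p) (coords x) = c *s coords q"
proof -
  have "cross (coords q) (cross (coords p) (coords x)) = 0"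
    using assms(2,3) by (simp add: cross_cross mem_dual_line)
  then obtain c where "cross (coords p) (coords x) = c *s coords q"
    using cross_eq_0 coords_nonzero by blast
  then show thesis using that cross_coords_nonzero[OF assms(1)] by (metis vector_smult_lzero)
qed

lemma line_through_unique:
  assumes "p \<noteq> x" "p \<in> dual_line q" "x \<in> dual_line q" "p \<in> dual_line q'" "x \<in> dual_line q'"
  shows "q = q'"
proof -
  obtain c where c: "c \<noteq> 0" "cross (coords p) (coords x) = c *s coords q"
    using coords_eq_cross assms(1-3) by metis
  obtain c' where c': "c' \<noteq> 0" "cross (coords p) (coords x) = c' *s coords q'"
    using coords_eq_cross assms(1,4,5) by metis
  have "coords q' = inverse c' *s (c' *s coords q')" using c'(1) by (simp add: vector_smult_assoc)
  also have "\<dots> = (inverse c' * c) *s coords q" using c c' by (metis vector_smult_assoc)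
  finally show ?thesis by (rule point_eqI)
qed

lemma line_through:
  assumes "p \<noteq> x"
  obtains q where "p \<in> dual_line q" "x \<in> dual_line q"
proof -
  obtain c where "coords (point_of (cross (coords p) (coords x))) = c *s cross (coords p) (coords x)"
    using coords_point_of cross_coords_nonzero[OF assms] by metis
  then show thesis
    using that[of "point_of (cross (coords p) (coords x))"] by (simp add: mem_dual_line)
qed

section \<open>Separating a point from a finite set\<close>

text \<open>The line a x x passes through \<open>x\<close>; it misses \<open>p\<close> as soon as a
  is off the line joining \<open>x\<close> and \<open>p\<close>.\<close>

lemma form_avoiding_point:
  assumes "x \<noteq> p"
  obtains v where "pairing v (coords x) = 0" "pairing v (coords p) \<noteq> 0"
proof -
  obtain a where "pairing (cross (coords x) (coords p)) a \<noteq> 0"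
    using cross_coords_nonzero[OF assms] exists_pairing_nonzero by metis
  then have "pairing (cross a (coords x)) (coords p) \<noteq> 0"
    by (metis pairing_cross_rotate pairing_commute)
  then show thesis using that[of "cross a (coords x)"] by simp
qed

text \<open>When x, y, p are not collinear, the line through \<open>x\<close> and \<open>y\<close>
  misses \<open>p\<close>.\<close>

lemma form_through_two_points:
  assumes "x \<noteq> p" "x \<in> dual_line q" "p \<in> dual_line q" "y \<notin> dual_line q"
  obtains v where "pairing v (coords x) = 0" "pairing v (coords y) = 0" "pairing v (coords p) \<noteq> 0"
proof -
  obtain c where "c \<noteq> 0" "cross (coords p) (coords x) = c *s coords q"
    using coords_eq_cross assms by metis
  then have "pairing (cross (coords p) (coords x)) (coords y) \<noteq> 0"
    using assms(4) by (simp add: mem_dual_line)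
  then have "pairing (cross (coords x) (coords y)) (coords p) \<noteq> 0"
    by (metis pairing_cross_rotate pairing_commute)
  then show thesis using that[of "cross (coords x) (coords y)"] by simp
qed

text \<open>Each of the \<open>j\<close> lines of the product takes care of at most two points. Choosing them on
  the two lines through \<open>p\<close> that contain most points keeps the bound on the number of points
  on the lines through \<open>p\<close>.\<close>

lemma separating_form:
  assumes "finite X" "p \<notin> X" "card X \<le> 2 * j"
    and "\<And>q. p \<in> dual_line q \<Longrightarrow> card (X \<inter> dual_line q) \<le> j"
  shows "\<exists>g. homogeneous j g \<and> (\<forall>x\<in>X. vanishes_at g x) \<and> \<not> vanishes_at g p"
  using assms
proof (induction j arbitrary: X)
  case 0
  then show ?case by (intro exI[of _ 1]) (simp add: vanishes_at_def)
next
  case (Suc j)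
  \<comment> \<open>One line missing \<open>p\<close> disposes of the points in \<open>R\<close>;
    the induction hypothesis supplies a form of degree \<open>j\<close> for the others.\<close>
  have step: ?case
    if v: "\<And>x. x \<in> R \<Longrightarrow> pairing v (coords x) = 0" "pairing v (coords p) \<noteq> 0"
      and R: "card (X - R) \<le> 2 * j" "\<And>q. p \<in> dual_line q \<Longrightarrow> card ((X - R) \<inter> dual_line q) \<le> j"
    for R v
  proof -
    obtain g where g: "homogeneous j g" "\<forall>x\<in>X - R. vanishes_at g x" "\<not> vanishes_at g p"
      using Suc.IH[of "X - R"] Suc.prems(1,2) R by auto
    have "homogeneous (Suc j) (linear_form v * g)"
      using homogeneous_mult[OF homogeneous_linear_form g(1)] by simp
    then show ?thesis
      using g v by (intro exI[of _ "linear_form v * g"]) (auto simp: vanishes_at_def)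
  qed
  \<comment> \<open>\<open>max\<close> gives a line through \<open>p\<close> richest in points of
    \<open>Y\<close>, the counts being bounded by \<open>card Y\<close>. By \<open>nonempty\<close>
    it does contain a point of \<open>Y\<close>, since the line joining \<open>p\<close> to
    \<open>y\<close> does.\<close>
  let ?n = "\<lambda>Y q. card (Y \<inter> dual_line q)"
  have max: "\<exists>q. p \<in> dual_line q \<and> (\<forall>q'. p \<in> dual_line q' \<longrightarrow> ?n Y q' \<le> ?n Y q)"
    if Y: "finite Y" "y \<in> Y" "y \<noteq> p" for Y y
  proof -
    obtain q where "p \<in> dual_line q" using line_through Y(3) by metis
    then show ?thesis
      using ex_has_greatest_nat[of "\<lambda>q. p \<in> dual_line q" q "?n Y" "Suc (card Y)"] Y(1)
      by (auto simp: less_Suc_eq_le card_mono)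
  qed
  have nonempty: "Y \<inter> dual_line q \<noteq> {}"
    if Y: "finite Y" "y \<in> Y" "y \<noteq> p" "\<forall>q'. p \<in> dual_line q' \<longrightarrow> ?n Y q' \<le> ?n Y q" for Y y q
  proof -
    obtain q' where "p \<in> dual_line q'" "y \<in> dual_line q'" using line_through Y(3) by metis
    moreover then have "0 < ?n Y q'" using Y(1,2) by (auto simp: card_gt_0_iff)
    ultimately have "0 < ?n Y q" using Y(4) by (meson less_le_trans)
    then show ?thesis by auto
  qed
  show ?case
  proof (cases "X = {}")
    case True
    obtain v where "pairing v (coords p) \<noteq> 0"
      using exists_pairing_nonzero[OF coords_nonzero] pairing_commute by metis
    then show ?thesis using True by (intro step[of "{}"]) auto
  next
    case False
    then obtain x0 where x0: "x0 \<in> X" "x0 \<noteq> p" using Suc.prems(2) by blast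
    obtain q1 where q1: "p \<in> dual_line q1" "\<forall>q. p \<in> dual_line q \<longrightarrow> ?n X q \<le> ?n X q1"
      using max[OF Suc.prems(1) x0] by blast
    then obtain x where x: "x \<in> X" "x \<in> dual_line q1"
      using nonempty[OF Suc.prems(1) x0 q1(2)] by blast
    have "x \<noteq> p" using x Suc.prems(2) by blast
    define Y where "Y = X - dual_line q1"
    have "finite Y" using Suc.prems(1) by (simp add: Y_def)
    have split: "card X = ?n X q1 + card Y"
      unfolding Y_def using Suc.prems(1) by (metis card_Int_Diff)
    show ?thesis
    proof (cases "Y = {}")
      case True
      obtain v where "pairing v (coords x) = 0" "pairing v (coords p) \<noteq> 0"
        using form_avoiding_point[OF \<open>x \<noteq> p\<close>] .
      moreover have "card (X - {x}) \<le> j"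
        \<comment> \<open>All of \<open>X\<close> lies on the line \<open>q1\<close> through
          \<open>p\<close>, so \<open>card X\<close> is at most \<open>Suc j\<close>, and dropping
          one point is enough.\<close>
        using split True Suc.prems(4)[OF q1(1)] Suc.prems(1) x by simp
      moreover have "card ((X - {x}) \<inter> dual_line q) \<le> card (X - {x})" for q
        using Suc.prems(1) by (intro card_mono) auto
      ultimately show ?thesis by (intro step[of "{x}"]) (auto intro: order_trans)
    next
      case False
      then obtain y0 where y0: "y0 \<in> Y" "y0 \<noteq> p" using Suc.prems(2) by (auto simp: Y_def)
      obtain q2 where q2: "p \<in> dual_line q2" "\<forall>q. p \<in> dual_line q \<longrightarrow> ?n Y q \<le> ?n Y q2"
        using max[OF \<open>finite Y\<close> y0] by blast
      then obtain y where y: "y \<in> Y" "y \<in> dual_line q2"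
        using nonempty[OF \<open>finite Y\<close> y0 q2(2)] by blast
      have y': "y \<in> X" "y \<notin> dual_line q1" using y by (auto simp: Y_def)
      have "y \<noteq> x" "y \<noteq> p" using x y' Suc.prems(2) by auto
      obtain v where v: "pairing v (coords x) = 0" "pairing v (coords y) = 0"
        "pairing v (coords p) \<noteq> 0"
        using form_through_two_points[OF \<open>x \<noteq> p\<close> x(2) q1(1) y'(2)] .
      have "card ((X - {x, y}) \<inter> dual_line q) \<le> j" if q: "p \<in> dual_line q" for q
      proof -
        have drop: ?thesis if "z \<in> {x, y}" "z \<in> dual_line q" for z
        proof -
          have "(X - {x, y}) \<inter> dual_line q \<subseteq> X \<inter> dual_line q - {z}" using that by auto
          then have "card ((X - {x, y}) \<inter> dual_line q) \<le> card (X \<inter> dual_line q - {z})"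
            using Suc.prems(1) by (intro card_mono) auto
          moreover have "z \<in> X \<inter> dual_line q" using that x y' by auto
          ultimately show ?thesis
            using Suc.prems(4)[OF q] Suc.prems(1) by (simp add: card_Diff_singleton)
        qed
        \<comment> \<open>A line through \<open>x\<close> or \<open>y\<close> loses a point. Any
          other \<open>q\<close> has no more points than \<open>q1\<close> has in \<open>X\<close>
          and \<open>q2\<close> in \<open>Y\<close>; these three point sets are disjoint, so three
          times the count on \<open>q\<close> is at most \<open>2 * Suc j\<close>, whence at most
          \<open>j\<close> points lie on \<open>q\<close>.\<close>
        consider "x \<in> dual_line q" | "y \<in> dual_line q" | "q \<noteq> q1" "q \<noteq> q2"
          using x y by blast
        then show ?thesis
        proof cases
          case 3
          have disj: "X \<inter> dual_line q \<inter> dual_line q' = {}" if "q' \<noteq> q" "p \<in> dual_line q'" for q'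
            using line_through_unique[of p _ q q'] q that Suc.prems(2)
            by (intro equals0I) (metis IntD1 IntD2)
          have XY: "X \<inter> dual_line q = Y \<inter> dual_line q"
            using disj[of q1] 3 q1 by (auto simp: Y_def)
          have "Y \<inter> dual_line q \<inter> (Y \<inter> dual_line q2) = {}"
            using disj[of q2] 3 q2 by (auto simp: Y_def)
          then have "?n Y q + ?n Y q2 = card (Y \<inter> dual_line q \<union> Y \<inter> dual_line q2)"
            using \<open>finite Y\<close> by (simp add: card_Un_disjoint)
          also have "\<dots> \<le> card Y" using \<open>finite Y\<close> by (intro card_mono) auto
          finally have "?n X q1 + (?n Y q + ?n Y q2) \<le> 2 * Suc j"
            using split Suc.prems(3) by simp
          moreover have "?n Y q \<le> ?n X q1" "?n Y q \<le> ?n Y q2"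
            using q1(2) q2(2) q XY by auto
          ultimately have "?n X q \<le> j" using XY by simp
          moreover have "card ((X - {x, y}) \<inter> dual_line q) \<le> ?n X q"
            using Suc.prems(1) by (intro card_mono) auto
          ultimately show ?thesis by simp
        qed (use drop in blast)+
      qed
      moreover have "card (X - {x, y}) \<le> 2 * j"
        using Suc.prems(1,3) x(1) y'(1) \<open>y \<noteq> x\<close> by (simp add: card_Diff_subset)
      ultimately show ?thesis using v by (intro step[of "{x, y}"]) auto
    qed
  qed
qed

section \<open>Dimensions of spaces of forms\<close>

text \<open>The first two exponents determine a monomial of degree \<open>j\<close>, and they range
  over a triangle with (j+2 choose 2) lattice points.\<close>

lemma span_monomials:
  fixes j :: nat
  defines "M \<equiv> {e :: monom3. (\<Sum>i\<in>UNIV. Poly_Mapping.lookup e i) = j}"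
  shows "finite M" "card M \<le> (j + 2) choose 2"
    "homogeneous j g \<Longrightarrow> g \<in> poly3.span ((\<lambda>e. Poly_Mapping.single e 1) ` M)"
proof -
  let ?\<phi> = "\<lambda>e :: monom3. (Poly_Mapping.lookup e 1, Poly_Mapping.lookup e 2)"
  let ?T = "SIGMA a:{..j}. {..j - a}"
  have inj: "inj_on ?\<phi> M"
  proof (rule inj_onI, rule poly_mapping_eqI)
    fix e e' :: monom3 and i assume "e \<in> M" "e' \<in> M" "?\<phi> e = ?\<phi> e'"
    then show "Poly_Mapping.lookup e i = Poly_Mapping.lookup e' i"
      using exhaust_3[of i] by (auto simp: M_def sum_3)
  qed
  have sub: "?\<phi> ` M \<subseteq> ?T" by (auto simp: M_def sum_3)
  have fin: "finite ?T" by simp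
  show "finite M" using finite_imageD[OF finite_subset[OF sub fin] inj] .
  have "card ?T = (\<Sum>a\<le>j. Suc (j - a))" by simp
  also have "\<dots> = (\<Sum>a\<le>j. Suc a)"
    by (rule sum.reindex_bij_witness[of _ "\<lambda>a. j - a" "\<lambda>a. j - a"]) auto
  also have "\<dots> = (j + 2) choose 2"
    by (induction j) (simp_all add: numeral_2_eq_2)
  finally show "card M \<le> (j + 2) choose 2"
    using card_mono[OF fin sub] card_image[OF inj] by simp
  assume g: "homogeneous j g"
  have "g = (\<Sum>e\<in>Poly_Mapping.keys g. poly_scale (Poly_Mapping.lookup g e) (Poly_Mapping.single e 1))"
    by (rule poly_mapping_eqI)
      (simp add: poly_scale_def mult_single lookup_sum lookup_single when_def in_keys_iff)
  also have "\<dots> \<in> poly3.span ((\<lambda>e. Poly_Mapping.single e 1) ` M)"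
    using g by (intro poly3.span_sum poly3.span_scale poly3.span_base)
      (auto simp: M_def homogeneous_def)
  finally show "g \<in> poly3.span ((\<lambda>e. Poly_Mapping.single e 1) ` M)" .
qed

text \<open>The full polynomial ring is infinite-dimensional, so bases of spaces of forms must be
  known to be finite before their cardinality is informative.\<close>

lemma independent_forms_bound:
  assumes "poly3.independent A" "\<And>g. g \<in> A \<Longrightarrow> homogeneous j g"
  shows "finite A" "card A \<le> (j + 2) choose 2"
proof -
  let ?M = "{e :: monom3. (\<Sum>i\<in>UNIV. Poly_Mapping.lookup e i) = j}"
  let ?S = "(\<lambda>e. Poly_Mapping.single e (1::complex)) ` ?M"
  have "A \<subseteq> poly3.span ?S" "finite ?S"
    using assms(2) span_monomials by auto
  then have "finite A \<and> card A \<le> card ?S" using poly3.independent_span_bound assms(1) by blast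
  moreover have "card ?S \<le> (j + 2) choose 2"
    using card_image_le[OF span_monomials(1)] span_monomials(2) by (rule order_trans)
  ultimately show "finite A" "card A \<le> (j + 2) choose 2" by simp_all
qed

lemma eval3_span_zero:
  assumes "g \<in> poly3.span B" "\<And>b. b \<in> B \<Longrightarrow> eval3 b v = 0"
  shows "eval3 g v = 0"
  using assms(1) by (induction rule: poly3.span_induct_alt) (simp_all add: assms(2))

text \<open>Evaluation at \<open>v x\<close> kills everything chosen before \<open>g x\<close> but
  not \<open>g x\<close> itself, so \<open>g x\<close> is outside the earlier span. A basis
  \<open>B\<close> of forms through \<open>Z\<close> yields the upper bound on
  \<open>h0_ideal\<close>; empty \<open>B\<close> yields the lower bound on
  \<open>h0_ideal_fat\<close>.\<close>

lemma independent_lagrange: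
  assumes "finite I" "finite B" "poly3.independent B"
    and "\<And>b i. b \<in> B \<Longrightarrow> i \<in> I \<Longrightarrow> eval3 b (v i) = 0"
    and "\<And>i. i \<in> I \<Longrightarrow> eval3 (g i) (v i) \<noteq> 0"
    and "\<And>i k. i \<in> I \<Longrightarrow> k \<in> I \<Longrightarrow> i \<noteq> k \<Longrightarrow> eval3 (g i) (v k) = 0"
  shows "poly3.independent (B \<union> g ` I) \<and> card (B \<union> g ` I) = card B + card I"
  using assms(1,4-6)
proof (induction rule: finite_induct)
  case empty
  then show ?case using assms(3) by simp
next
  case (insert x I)
  have "eval3 b (v x) = 0" if "b \<in> B \<union> g ` I" for b
    using that insert.prems(1,3) insert.hyps(2) by blast
  then have "g x \<notin> poly3.span (B \<union> g ` I)"
    using eval3_span_zero insert.prems(2) by blast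
  moreover then have "g x \<notin> B \<union> g ` I" by (metis poly3.span_base)
  ultimately show ?case
    using insert.IH insert.prems insert.hyps assms(2) by (simp add: poly3.independent_insert)
qed

text \<open>A basis of the forms vanishing on \<open>Z\<close>, enlarged by one separating form for
  each point of \<open>X\<close>, stays independent among the forms of degree \<open>j\<close>: the
  points of \<open>X\<close> impose independent conditions.\<close>

lemma h0_ideal_bound:
  assumes "finite X" "X \<subseteq> Z"
    and "\<And>x. x \<in> X \<Longrightarrow> \<exists>g. homogeneous j g \<and> (\<forall>y\<in>X - {x}. vanishes_at g y) \<and> \<not> vanishes_at g x"
  shows "h0_ideal j Z + card X \<le> (j + 2) choose 2"
proof -
  let ?V = "{g. homogeneous j g \<and> (\<forall>p\<in>Z. vanishes_at g p)}"
  obtain B where B: "B \<subseteq> ?V" "poly3.independent B" "?V \<subseteq> poly3.span B" "card B = poly3.dim ?V"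
    using poly3.basis_exists by blast
  then have "finite B" using independent_forms_bound by blast
  obtain g where g: "\<And>x. x \<in> X \<Longrightarrow> homogeneous j (g x)"
    "\<And>x y. x \<in> X \<Longrightarrow> y \<in> X \<Longrightarrow> x \<noteq> y \<Longrightarrow> vanishes_at (g x) y"
    "\<And>x. x \<in> X \<Longrightarrow> \<not> vanishes_at (g x) x"
    using assms(3) by (metis Diff_iff singletonD)
  have "poly3.independent (B \<union> g ` X) \<and> card (B \<union> g ` X) = card B + card X"
    using assms(1,2) \<open>finite B\<close> B(1,2) g
    by (intro independent_lagrange[where v = coords]) (auto simp: vanishes_at_def)
  moreover have "homogeneous j h" if "h \<in> B \<union> g ` X" for h
    using that B(1) g(1) by auto
  ultimately show ?thesis
    using independent_forms_bound(2)[of "B \<union> g ` X" j] B(4) by (simp add: h0_ideal_def)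
qed

lemma card_le_dim:
  assumes "poly3.independent A" "A \<subseteq> V" "\<And>g. g \<in> V \<Longrightarrow> homogeneous j g"
  shows "card A \<le> poly3.dim V"
proof -
  obtain B where B: "B \<subseteq> V" "poly3.independent B" "V \<subseteq> poly3.span B" "card B = poly3.dim V"
    using poly3.basis_exists by blast
  then have "finite B" using independent_forms_bound(1) assms(3) by blast
  then show ?thesis
    using poly3.independent_span_bound[of B A] assms(1,2) B by auto
qed

section \<open>Order of vanishing\<close>

lemma vanishes_to_order_0 [simp]: "vanishes_to_order 0 g q"
  by (simp add: vanishes_to_order_def)

text \<open>\<open>fold\<close> applies the head of the list first, so splitting it off gives a
  recursion on the order, used in the inductions below.\<close>

lemma vanishes_to_order_Suc:
  "vanishes_to_order (Suc k) g q \<longleftrightarrow>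
    vanishes_at g q \<and> (\<forall>i. vanishes_to_order k (partial i g) q)"
proof
  assume *: "vanishes_to_order (Suc k) g q"
  have "vanishes_at (fold partial is (partial i g)) q" if "length is < k" for i "is"
    using * that unfolding vanishes_to_order_def by (metis Suc_less_eq fold_simps(2) length_Cons)
  moreover have "vanishes_at (fold partial [] g) q"
    using * unfolding vanishes_to_order_def by (metis list.size(3) zero_less_Suc)
  ultimately show "vanishes_at g q \<and> (\<forall>i. vanishes_to_order k (partial i g) q)"
    by (simp add: vanishes_to_order_def)
next
  assume *: "vanishes_at g q \<and> (\<forall>i. vanishes_to_order k (partial i g) q)"
  show "vanishes_to_order (Suc k) g q"
    unfolding vanishes_to_order_def
  proof (intro allI impI)
    fix "is" :: "3 list" assume "length is < Suc k"
    then show "vanishes_at (fold partial is g) q"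
      using * by (cases "is") (auto simp: vanishes_to_order_def)
  qed
qed

lemma vanishes_to_order_SucD: "vanishes_to_order (Suc k) g q \<Longrightarrow> vanishes_to_order k g q"
  by (simp add: vanishes_to_order_def)

lemma vanishes_to_order_add:
  "vanishes_to_order k f q \<Longrightarrow> vanishes_to_order k g q \<Longrightarrow> vanishes_to_order k (f + g) q"
  by (induction k arbitrary: f g) (simp_all add: vanishes_to_order_Suc vanishes_at_def)

lemma vanishes_to_order_mult:
  "vanishes_to_order k g q \<Longrightarrow> vanishes_to_order k (h * g) q"
proof (induction k arbitrary: g h)
  case (Suc k)
  have "vanishes_to_order k (partial i (h * g)) q" for i
    using Suc.prems vanishes_to_order_SucD[OF Suc.prems] unfolding partial_mult
    by (intro vanishes_to_order_add Suc.IH) (auto simp: vanishes_to_order_Suc)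
  then show ?case using Suc.prems by (simp add: vanishes_to_order_Suc vanishes_at_def)
qed simp

lemma vanishes_to_order_zero [simp]: "vanishes_to_order k 0 q"
  by (induction k) (simp_all add: vanishes_to_order_Suc vanishes_at_def)

lemma vanishes_to_order_sum:
  "(\<And>x. x \<in> A \<Longrightarrow> vanishes_to_order k (g x) q) \<Longrightarrow> vanishes_to_order k (\<Sum>x\<in>A. g x) q"
  by (induction A rule: infinite_finite_induct) (simp_all add: vanishes_to_order_add)

text \<open>By the Leibniz rule a derivative of the product is a constant times \<open>g\<close>,
  plus the linear form times a derivative of \<open>g\<close>; the induction hypothesis handles the
  second term.\<close>

lemma vanishes_to_order_linear_mult:
  assumes "pairing u (coords q) = 0" "vanishes_to_order k g q"
  shows "vanishes_to_order (Suc k) (linear_form u * g) q"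
  using assms(2)
proof (induction k arbitrary: g)
  case 0
  then show ?case
    using assms(1) by (simp add: vanishes_to_order_Suc vanishes_at_def)
next
  case (Suc k)
  have "vanishes_to_order (Suc k) (partial i (linear_form u * g)) q" for i
    using Suc unfolding partial_mult
    by (intro vanishes_to_order_add Suc.IH vanishes_to_order_mult)
      (auto simp: vanishes_to_order_Suc[of k])
  then show ?case
    using assms(1) vanishes_to_order_Suc[of "Suc k"] by (simp add: vanishes_at_def)
qed

lemma vanishes_to_order_linear_power_mult:
  assumes "pairing u (coords q) = 0" "vanishes_to_order k g q"
  shows "vanishes_to_order (n + k) (linear_form u ^ n * g) q"
  using assms by (induction n) (simp_all add: vanishes_to_order_linear_mult mult.assoc)

lemma vanishes_to_order_prod_linear_mult:
  assumes "\<And>x. x \<in> A \<Longrightarrow> pairing (u x) (coords q) = 0" "vanishes_to_order k g q"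
  shows "vanishes_to_order (card A + k) ((\<Prod>x\<in>A. linear_form (u x)) * g) q"
  using assms
  by (induction A rule: infinite_finite_induct)
    (simp_all add: vanishes_to_order_linear_mult mult.assoc)

text \<open>Each monomial of degree \<open>r\<close> turns into a product of \<open>r\<close> linear
  forms vanishing at \<open>q\<close>.\<close>

lemma vanishes_to_order_subst:
  assumes "homogeneous r g" "\<And>i. pairing (u i) (coords q) = 0"
  shows "vanishes_to_order r (subst_poly g (\<lambda>i. linear_form (u i))) q"
  unfolding subst_poly_def poly_scale_def
proof (intro vanishes_to_order_sum vanishes_to_order_mult)
  fix e assume "e \<in> Poly_Mapping.keys g"
  then have r: "r = (\<Sum>i\<in>UNIV. Poly_Mapping.lookup e i)"
    using assms(1) by (simp add: homogeneous_def)
  have "vanishes_to_order (\<Sum>i\<in>A. Poly_Mapping.lookup e i)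
      (\<Prod>i\<in>A. linear_form (u i) ^ Poly_Mapping.lookup e i) q" for A
    by (induction A rule: infinite_finite_induct)
      (simp_all add: vanishes_to_order_linear_power_mult assms(2))
  then show "vanishes_to_order r (\<Prod>i\<in>UNIV. linear_form (u i) ^ Poly_Mapping.lookup e i) q"
    by (simp add: r)
qed

section \<open>Jacobian relations as vector fields\<close>

text \<open>The minimum in \<open>mdr\<close> is attained because some relation exists: the Koszul
  relation between the first two partial derivatives, or, if both vanish, a constant one.\<close>

lemma mdr_relation:
  assumes f: "homogeneous n f"
  obtains \<theta> :: "3 \<Rightarrow> poly3" and i where "\<And>i. homogeneous (mdr f) (\<theta> i)" "\<theta> i \<noteq> 0"
    "(\<Sum>i\<in>UNIV. \<theta> i * partial i f) = 0"
proof -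
  let ?P = "\<lambda>r. \<exists>a b c. homogeneous r a \<and> homogeneous r b \<and> homogeneous r c \<and>
      \<not> (a = 0 \<and> b = 0 \<and> c = 0) \<and> a * partial 1 f + b * partial 2 f + c * partial 3 f = 0"
  have "\<exists>r. ?P r"
  proof (cases "partial 1 f = 0 \<and> partial 2 f = 0")
    case True
    then show ?thesis by (intro exI[of _ 0] exI[of _ 1]) auto
  next
    case False
    have "homogeneous (n - 1) (partial i f)" for i using homogeneous_partial[OF f] .
    moreover from this have "homogeneous (n - 1) (- partial 1 f)"
      by (metis homogeneous_scale poly3.scale_minus_left poly3.scale_one)
    ultimately show ?thesis
      using False
      by (intro exI[of _ "n - 1"] exI[of _ "partial 2 f"] exI[of _ "- partial 1 f"] exI[of _ 0])
        (auto simp: algebra_simps)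
  qed
  then have "?P (mdr f)" unfolding mdr_def by (rule LeastI_ex)
  then obtain a b c where abc: "homogeneous (mdr f) a" "homogeneous (mdr f) b" "homogeneous (mdr f) c"
    "\<not> (a = 0 \<and> b = 0 \<and> c = 0)" "a * partial 1 f + b * partial 2 f + c * partial 3 f = 0"
    by blast
  define \<theta> :: "3 \<Rightarrow> poly3" where "\<theta> i = (if i = 1 then a else if i = 2 then b else c)" for i
  have \<theta>: "\<theta> 1 = a" "\<theta> 2 = b" "\<theta> 3 = c" by (simp_all add: \<theta>_def)
  then obtain i where "\<theta> i \<noteq> 0" using abc(4) by metis
  moreover have "homogeneous (mdr f) (\<theta> i)" for i using abc(1-3) by (simp add: \<theta>_def)
  moreover have "(\<Sum>i\<in>UNIV. \<theta> i * partial i f) = 0" using abc(5) by (simp add: sum_3 \<theta>)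
  ultimately show thesis using that by blast
qed

abbreviation field_at :: "(3 \<Rightarrow> poly3) \<Rightarrow> complex ^ 3 \<Rightarrow> complex ^ 3" where
  "field_at \<theta> w \<equiv> (\<chi> i. eval3 (\<theta> i) w)"

text \<open>The Leibniz rule for the derivative in direction \<open>x\<close>. It is applied to the
  direction of the field and to \<open>x = w\<close>, where it becomes Euler's formula.\<close>

lemma derivative_dual_poly:
  assumes "finite Z"
  shows "(\<Sum>i\<in>UNIV. x $ i * eval3 (partial i (dual_poly Z)) w) =
    (\<Sum>z\<in>Z. pairing (coords z) x * (\<Prod>z'\<in>Z - {z}. pairing (coords z') w))"
proof -
  have "(\<Sum>i\<in>UNIV. x $ i * eval3 (partial i (dual_poly Z)) w) =
      (\<Sum>i\<in>UNIV. \<Sum>z\<in>Z. coords z $ i * x $ i * (\<Prod>z'\<in>Z - {z}. pairing (coords z') w))"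
    unfolding dual_poly_def eval3_partial_prod[OF assms] sum_distrib_left
    by (intro sum.cong) (simp_all add: mult_ac)
  also have "\<dots> = (\<Sum>z\<in>Z. \<Sum>i\<in>UNIV. coords z $ i * x $ i * (\<Prod>z'\<in>Z - {z}. pairing (coords z') w))"
    by (rule sum.swap)
  finally show ?thesis by (simp add: pairing_def sum_distrib_right)
qed

context
  fixes Z :: "proj_plane set" and \<theta> :: "3 \<Rightarrow> poly3"
  assumes finite_Z: "finite Z"
    and relation: "(\<Sum>i\<in>UNIV. \<theta> i * partial i (dual_poly Z)) = 0"
begin

lemma relation_at: "(\<Sum>i\<in>UNIV. field_at \<theta> w $ i * eval3 (partial i (dual_poly Z)) w) = 0"
  using arg_cong[OF relation, of "\<lambda>g. eval3 g w"] by simp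

text \<open>Away from the other lines, the product rule exhibits the restriction of the relation
  to a line as a nonzero multiple of the derivative of its equation along the field.\<close>

lemma field_tangent:
  assumes "z \<in> Z" "pairing (coords z) w = 0"
  shows "pairing (coords z) (field_at \<theta> w) = 0"
proof (rule ccontr)
  assume nz: "pairing (coords z) (field_at \<theta> w) \<noteq> 0"
  define S where "S = {w. pairing (coords z) w = 0}"
  have S: "affine_closed S" unfolding S_def by (rule affine_closed_orthogonal)
  define h where "h = (\<Sum>i\<in>UNIV. poly_scale (coords z $ i) (\<theta> i))"
  have h: "eval3 h v = pairing (coords z) (field_at \<theta> v)" for v
    by (simp add: h_def pairing_def)
  have "\<exists>v\<in>S. eval3 (linear_form (coords z')) v \<noteq> 0" if "z' \<in> Z - {z}" for z'
  proof -
    have "z' \<noteq> z" using that by simp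
    then obtain a where "pairing (cross (coords z') (coords z)) a \<noteq> 0"
      using exists_pairing_nonzero cross_coords_nonzero by metis
    then show ?thesis
      by (intro bexI[of _ "cross (coords z) a"]) (simp_all add: S_def pairing_cross_rotate)
  qed
  moreover have "w \<in> S" using assms(2) by (simp add: S_def)
  ultimately obtain u where "u \<in> S" "\<forall>z'\<in>Z - {z}. pairing (coords z') u \<noteq> 0"
    using common_nonzero_finite[OF S, of "Z - {z}" "\<lambda>z'. linear_form (coords z')"] finite_Z
    by auto
  then have "eval3 (\<Prod>z'\<in>Z - {z}. linear_form (coords z')) u \<noteq> 0"
    using finite_Z by simp
  \<comment> \<open>Nonvanishing at \<open>w\<close> is moved within the plane \<open>S\<close> to a
    point off all the other lines.\<close>
  then obtain v where v: "v \<in> S" "eval3 h v \<noteq> 0"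
    "eval3 (\<Prod>z'\<in>Z - {z}. linear_form (coords z')) v \<noteq> 0"
    using common_nonzero[OF S \<open>w \<in> S\<close> _ \<open>u \<in> S\<close>] nz h by metis
  \<comment> \<open>Every summand but that of \<open>z\<close> contains the factor of
    \<open>z\<close>, which is zero at \<open>v\<close>.\<close>
  have "(\<Prod>z'\<in>Z - {y}. pairing (coords z') v) = 0" if "y \<in> Z - {z}" for y
    using that assms(1) v(1) finite_Z by (auto simp: S_def intro!: prod_zero)
  then have "pairing (coords z) (field_at \<theta> v) * (\<Prod>z'\<in>Z - {z}. pairing (coords z') v) = 0"
    using relation_at[of v] derivative_dual_poly[OF finite_Z, of "field_at \<theta> v" v]
      sum.remove[OF finite_Z assms(1), of "\<lambda>z. pairing (coords z) (field_at \<theta> v) *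
        (\<Prod>z'\<in>Z - {z}. pairing (coords z') v)"]
    by simp
  then show False using v h by simp
qed

text \<open>A field parallel to the Euler field would map the defining polynomial to a nonzero
  multiple of itself.\<close>

lemma field_not_radial:
  assumes "Z \<noteq> {}" "\<theta> i \<noteq> 0" "u \<noteq> 0"
  obtains w where "cross (field_at \<theta> w) w \<noteq> 0" "pairing u w \<noteq> 0"
proof -
  obtain w1 where w1: "eval3 (\<theta> i) w1 \<noteq> 0" using eval3_nonzero[OF assms(2)] .
  obtain w2 where w2: "pairing u w2 \<noteq> 0" using exists_pairing_nonzero[OF assms(3)] .
  have "\<exists>v. pairing (coords z) v \<noteq> 0" for z
    using exists_pairing_nonzero[OF coords_nonzero] by metis
  then obtain w3 where w3: "\<forall>z\<in>Z. pairing (coords z) w3 \<noteq> 0"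
    using common_nonzero_finite[OF affine_closed_UNIV finite_Z, of "\<lambda>z. linear_form (coords z)"]
    by auto
  then have "eval3 (dual_poly Z) w3 \<noteq> 0" using finite_Z by (simp add: dual_poly_def)
  then obtain w4 where "eval3 (\<theta> i) w4 \<noteq> 0" "eval3 (dual_poly Z) w4 \<noteq> 0"
    using common_nonzero[OF affine_closed_UNIV _ w1, of w3 "dual_poly Z"] by auto
  \<comment> \<open>The last condition is meant for \<open>u\<close> the coordinates of p': the line
    with coordinates \<open>w\<close> then misses p'.\<close>
  then obtain w where w: "eval3 (\<theta> i) w \<noteq> 0" "eval3 (dual_poly Z) w \<noteq> 0" "pairing u w \<noteq> 0"
    using common_nonzero[OF affine_closed_UNIV, of w4 "\<theta> i * dual_poly Z" w2 "linear_form u"] w2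
    by auto
  have "cross (field_at \<theta> w) w \<noteq> 0"
  proof
    assume "cross (field_at \<theta> w) w = 0"
    moreover have "field_at \<theta> w \<noteq> 0" using w(1) by (auto simp: vec_eq_iff)
    \<comment> \<open>As the field is nonzero at \<open>w\<close>, it is \<open>w\<close> that is a
      multiple of the field. The derivative along \<open>w\<close> is therefore 0, whereas Euler's
      formula gives \<open>card Z\<close> times a nonzero value.\<close>
    ultimately obtain c where c: "w = c *s field_at \<theta> w" using cross_eq_0 by metis
    have "(\<Sum>i\<in>UNIV. w $ i * eval3 (partial i (dual_poly Z)) w) =
        (\<Sum>i\<in>UNIV. c * (field_at \<theta> w $ i * eval3 (partial i (dual_poly Z)) w))"
      using c by (metis (no_types, lifting) mult.assoc vector_smult_component)
    then have "(\<Sum>i\<in>UNIV. w $ i * eval3 (partial i (dual_poly Z)) w) = 0"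
      unfolding sum_distrib_left[symmetric] relation_at by simp
    moreover have "pairing (coords z) w * (\<Prod>z'\<in>Z - {z}. pairing (coords z') w) =
        eval3 (dual_poly Z) w" if "z \<in> Z" for z
      using prod.remove[OF finite_Z that, of "\<lambda>z. pairing (coords z) w"] by (simp add: dual_poly_def)
    ultimately have "of_nat (card Z) * eval3 (dual_poly Z) w = 0"
      using derivative_dual_poly[OF finite_Z, of w w] by simp
    then show False using w(2) assms(1) finite_Z by simp
  qed
  then show thesis using that w(3) by blast
qed

end

section \<open>Curves attached to a vector field\<close>

text \<open>The form P . \<theta>(P x q) in P: the k-th coordinate of P x q is the linear form with
  coefficient vector q x e_k, evaluated at P.\<close>

definition field_curve :: "(3 \<Rightarrow> poly3) \<Rightarrow> complex ^ 3 \<Rightarrow> poly3" where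
  "field_curve \<theta> q = (\<Sum>i\<in>UNIV. linear_form (axis i 1) *
      subst_poly (\<theta> i) (\<lambda>k. linear_form (cross q (axis k 1))))"

lemma eval3_field_curve: "eval3 (field_curve \<theta> q) P = pairing P (field_at \<theta> (cross P q))"
proof -
  have "pairing (cross q (axis k 1)) P = cross P q $ k" for k
    by (metis pairing_axis(1) pairing_commute pairing_cross_rotate)
  then have "(\<chi> k. eval3 (linear_form (cross q (axis k 1))) P) = cross P q"
    by (simp add: vec_eq_iff)
  then show ?thesis by (simp add: field_curve_def eval3_subst pairing_def[of P])
qed

lemma homogeneous_field_curve:
  assumes "\<And>i. homogeneous r (\<theta> i)"
  shows "homogeneous (Suc r) (field_curve \<theta> q)"
  unfolding field_curve_def
  using homogeneous_mult[OF homogeneous_linear_form homogeneous_subst[OF assms]]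
  by (intro homogeneous_sum) simp

lemma field_curve_vanishes_to_order:
  assumes "\<And>i. homogeneous r (\<theta> i)"
  shows "vanishes_to_order r (field_curve \<theta> (coords q)) q"
  unfolding field_curve_def using assms
  by (intro vanishes_to_order_sum vanishes_to_order_mult vanishes_to_order_subst) simp_all

text \<open>For fixed P the value is a form in the centre q, so its nonvanishing is a Zariski open
  condition on q.\<close>

lemma field_curve_polynomial_in_centre:
  assumes "\<And>i. homogeneous r (\<theta> i)"
  obtains G where "homogeneous r G" "\<And>q. eval3 G q = eval3 (field_curve \<theta> q) P"
proof
  let ?G = "\<Sum>i\<in>UNIV. poly_scale (P $ i)
      (subst_poly (\<theta> i) (\<lambda>k. linear_form (cross (axis k 1) P)))"
  show "homogeneous r ?G"
    using assms by (intro homogeneous_sum homogeneous_scale homogeneous_subst) simp_all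
  fix q
  have "(\<chi> k. eval3 (linear_form (cross (axis k 1) P)) q) = cross P q"
    by (simp add: vec_eq_iff pairing_cross_rotate)
  then show "eval3 ?G q = eval3 (field_curve \<theta> q) P"
    by (simp add: eval3_subst eval3_field_curve pairing_def[of P])
qed

text \<open>For P = w x a and q = w x b the product P x q is a multiple of \<open>w\<close>. By
  homogeneity the value is then a nonzero factor times the determinant of w, a, \<theta>(w), and a
  is chosen to make this nonzero.\<close>

lemma field_curve_nonzero:
  assumes "cross (field_at \<theta> w) w \<noteq> 0" "\<And>i. homogeneous r (\<theta> i)"
  obtains P q c where "c \<noteq> 0" "cross P q = c *s w" "eval3 (field_curve \<theta> q) P \<noteq> 0"
proof -
  obtain a where a: "pairing (cross (field_at \<theta> w) w) a \<noteq> 0"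
    using exists_pairing_nonzero[OF assms(1)] .
  then have P: "pairing (cross w a) (field_at \<theta> w) \<noteq> 0"
    by (metis pairing_cross_rotate pairing_commute)
  then have "cross w a \<noteq> 0" by (metis pairing_simps(4))
  then obtain b where b: "pairing (cross w a) b \<noteq> 0" using exists_pairing_nonzero by blast
  let ?c = "pairing (cross w a) b"
  have "field_at \<theta> (?c *s w) = ?c ^ r *s field_at \<theta> w"
    by (simp add: vec_eq_iff eval3_homogeneous[OF assms(2)])
  then have "eval3 (field_curve \<theta> (cross w b)) (cross w a) \<noteq> 0"
    using P b by (simp add: eval3_field_curve cross_cross_common)
  then show thesis using that[OF b cross_cross_common] by blast
qed

text \<open>These points serve as interpolation nodes: the line from q to one of them misses all the
  others. A new node is taken off \<open>H = 0\<close> and off the finitely many lines already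
  present.\<close>

lemma points_on_distinct_lines:
  assumes "eval3 H v \<noteq> 0" "\<And>P. eval3 H P \<noteq> 0 \<Longrightarrow> cross P q \<noteq> 0"
  shows "\<exists>P :: nat \<Rightarrow> complex ^ 3. \<forall>s<n. eval3 H (P s) \<noteq> 0 \<and>
    (\<forall>t<n. s \<noteq> t \<longrightarrow> pairing (cross (P s) q) (P t) \<noteq> 0)"
proof (induction n)
  case (Suc n)
  then obtain P :: "nat \<Rightarrow> complex ^ 3" where P: "\<And>s. s < n \<Longrightarrow> eval3 H (P s) \<noteq> 0"
    "\<And>s t. s < n \<Longrightarrow> t < n \<Longrightarrow> s \<noteq> t \<Longrightarrow> pairing (cross (P s) q) (P t) \<noteq> 0" by blast
  have "\<exists>v. pairing (cross (P s) q) v \<noteq> 0" if "s < n" for s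
    using exists_pairing_nonzero assms(2) P(1)[OF that] by metis
  then obtain w where w: "\<forall>s<n. pairing (cross (P s) q) w \<noteq> 0"
    using common_nonzero_finite[OF affine_closed_UNIV, of "{..<n}" "\<lambda>s. linear_form (cross (P s) q)"]
    by auto
  then have "eval3 (\<Prod>s<n. linear_form (cross (P s) q)) w \<noteq> 0" by simp
  then obtain x where x: "eval3 H x \<noteq> 0" "eval3 (\<Prod>s<n. linear_form (cross (P s) q)) x \<noteq> 0"
    using common_nonzero[OF affine_closed_UNIV _ assms(1)] by blast
  have x': "pairing (cross (P s) q) x \<noteq> 0" if "s < n" for s
    using x(2) that by auto
  have "pairing (cross x q) (P s) = - pairing (cross (P s) q) x" for s
    by (simp add: pairing_3 algebra_simps)
  then have x'': "pairing (cross x q) (P s) \<noteq> 0" if "s < n" for s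
    using x'[OF that] by simp
  show ?case
    by (rule exI[of _ "P(n := x)"]) (use P x(1) x' x'' in \<open>auto simp: less_Suc_eq\<close>)
qed simp

text \<open>With nodes P 0, ..., P k, the form \<open>g i\<close> is the product of the
  \<open>k\<close> lines from q to the nodes other than P i, the line through q and p, and the field
  curve. Its degree is k + 1 + (r + 1), its order at q is at least k + 1 + r, and P i is the one
  node where it is nonzero.\<close>

lemma h0_ideal_fat_bound:
  assumes "finite Z" "\<And>i. homogeneous r (\<theta> i)"
    and tangent: "\<And>z w. z \<in> Z \<Longrightarrow> pairing (coords z) w = 0 \<Longrightarrow>
      pairing (coords z) (field_at \<theta> w) = 0"
    and nz: "eval3 (field_curve \<theta> (coords q)) v \<noteq> 0" "pairing (coords p) (cross v (coords q)) \<noteq> 0"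
  shows "k < h0_ideal_fat (r + k + 2) (insert p Z) (r + k + 1) q"
proof -
  let ?q = "coords q"
  let ?l = "linear_form (cross ?q (coords p))"
  let ?H = "?l * field_curve \<theta> ?q"
  have l: "pairing (cross ?q (coords p)) P = pairing (coords p) (cross P ?q)" for P
    by (simp add: pairing_3 algebra_simps)
  have "eval3 ?H v \<noteq> 0" using nz by (simp add: l)
  moreover have "cross P ?q \<noteq> 0" if "eval3 ?H P \<noteq> 0" for P
    using that by (auto simp: l)
  ultimately obtain P :: "nat \<Rightarrow> complex ^ 3" where P: "\<And>s. s < Suc k \<Longrightarrow> eval3 ?H (P s) \<noteq> 0"
    "\<And>s t. s < Suc k \<Longrightarrow> t < Suc k \<Longrightarrow> s \<noteq> t \<Longrightarrow> pairing (cross (P s) ?q) (P t) \<noteq> 0"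
    using points_on_distinct_lines[of ?H v ?q "Suc k"] by blast
  define g where "g i = (\<Prod>s\<in>{..k} - {i}. linear_form (cross (P s) ?q)) * ?H" for i
  have indep: "poly3.independent ({} \<union> g ` {..k}) \<and> card ({} \<union> g ` {..k}) = card ({} :: poly3 set) + card {..k}"
  proof (rule independent_lagrange[where v = P and g = g and B = "{}" and I = "{..k}"])
    fix i t assume "i \<in> {..k}" "t \<in> {..k}" "i \<noteq> t"
    then have "(\<Prod>s\<in>{..k} - {i}. pairing (cross (P s) ?q) (P t)) = 0"
      by (intro prod_zero bexI[of _ t]) auto
    then show "eval3 (g i) (P t) = 0" by (simp add: g_def)
  next
    fix i assume "i \<in> {..k}"
    then show "eval3 (g i) (P i) \<noteq> 0"
      using P by (auto simp: g_def less_Suc_eq_le)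
  qed (auto simp: poly3.independent_empty)
  have mem: "g i \<in> {g. homogeneous (r + k + 2) g \<and> (\<forall>z\<in>insert p Z. vanishes_at g z) \<and>
      vanishes_to_order (r + k + 1) g q}" if "i \<le> k" for i
  proof (intro CollectI conjI ballI)
    have "homogeneous (card ({..k} - {i}) + (Suc 0 + Suc r)) (g i)"
      unfolding g_def
      using assms(2) by (intro homogeneous_mult homogeneous_prod_linear_form homogeneous_linear_form
          homogeneous_field_curve)
    then show "homogeneous (r + k + 2) (g i)" using that by (simp add: add_ac)
    have "vanishes_to_order (card ({..k} - {i}) + Suc r) (g i) q"
      unfolding g_def
      using assms(2) by (intro vanishes_to_order_prod_linear_mult vanishes_to_order_linear_mult
          field_curve_vanishes_to_order) simp_all
    then show "vanishes_to_order (r + k + 1) (g i) q" using that by (simp add: add_ac)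
    \<comment> \<open>At \<open>p\<close> the factor \<open>?l\<close> vanishes. For z in
      \<open>Z\<close>, the vector z x q lies on the line dual to z, so tangency makes the field
      curve vanish at z.\<close>
    fix z assume "z \<in> insert p Z"
    then show "vanishes_at (g i) z"
      using tangent[of z "cross (coords z) ?q"]
      by (auto simp: vanishes_at_def g_def eval3_field_curve)
  qed
  have "card (g ` {..k}) \<le> h0_ideal_fat (r + k + 2) (insert p Z) (r + k + 1) q"
    unfolding h0_ideal_fat_def using indep mem
    by (intro card_le_dim[where j = "r + k + 2"]) auto
  then show ?thesis using indep by simp
qed

section \<open>Generic points\<close>

lemma generically_onI:
  assumes "homogeneous r G" "p \<in> X" "\<not> vanishes_at G p"
    and "\<And>p. p \<in> X \<Longrightarrow> \<not> vanishes_at G p \<Longrightarrow> Q p"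
  shows "generically_on X Q"
  unfolding generically_on_def
proof (intro exI conjI)
  show "zariski_open {p. \<not> vanishes_at G p}"
    unfolding zariski_open_def zariski_closed_def
    using assms(1) by (intro exI[of _ "{G}"]) auto
qed (use assms in auto)

lemma dual_line_nonempty:
  obtains x where "x \<in> dual_line p"
proof -
  let ?u = "coords p"
  let ?w = "vector [?u $ 2, - ?u $ 1, 0] :: complex ^ 3"
  have "\<exists>w. w \<noteq> 0 \<and> pairing ?u w = 0"
  proof (cases "?w = 0")
    case True
    then have "?u $ 1 = 0" by (simp add: vec_eq_iff forall_3)
    then show ?thesis
      by (intro exI[of _ "axis 1 1"]) (simp add: axis_eq_0_iff)
  next
    case False
    then show ?thesis by (intro exI[of _ ?w]) (simp add: pairing_3)
  qed
  then obtain w where "w \<noteq> 0" "pairing ?u w = 0" by blast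
  moreover then obtain c where "coords (point_of w) = c *s w" using coords_point_of by metis
  ultimately show thesis using that[of "point_of w"] by (simp add: mem_dual_line)
qed

text \<open>Fix a point a off \<open>L\<close>. The line joining a to a point z of \<open>L\<close>
  meets \<open>L\<close> in z alone, so the product of such lines cuts out the points to be
  avoided.\<close>

lemma generically_on_line_notin:
  assumes "finite Z" "is_line L"
  shows "generically_on L (\<lambda>p. p \<notin> Z)"
proof -
  obtain p0 where L: "L = dual_line p0" using assms(2) by (auto simp: is_line_def)
  obtain x where "x \<in> L" using dual_line_nonempty L by metis
  let ?u = "coords p0"
  let ?S = "{w. pairing ?u w = 0}"
  \<comment> \<open>The extra point \<open>x\<close> keeps the set nonempty; since
    \<open>l x\<close> is nonzero at the vector \<open>w\<close> found below, \<open>w\<close> is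
    not 0 and defines a point.\<close>
  let ?A = "insert x (Z \<inter> L)"
  obtain a where a: "pairing ?u a \<noteq> 0" using exists_pairing_nonzero[OF coords_nonzero] .
  define l where "l z = linear_form (cross (coords z) a)" for z
  have "\<exists>v\<in>?S. eval3 (l z) v \<noteq> 0" if "z \<in> ?A" for z
  proof -
    \<comment> \<open>For z on \<open>L\<close>, the Binet-Cauchy identity evaluates
      \<open>l z\<close> at u x b to minus (z . b)(a . u), which is nonzero.\<close>
    obtain b where "pairing (coords z) b \<noteq> 0" using exists_pairing_nonzero[OF coords_nonzero] .
    then show ?thesis
      using a that \<open>x \<in> L\<close> by (intro bexI[of _ "cross ?u b"])
        (auto simp: l_def pairing_cross_cross L mem_dual_line pairing_commute)
  qed
  moreover have "0 \<in> ?S" by simp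
  ultimately obtain w where w: "w \<in> ?S" "\<forall>z\<in>?A. eval3 (l z) w \<noteq> 0"
    using common_nonzero_finite[OF affine_closed_orthogonal, of ?A ?u l] assms(1) by blast
  then have "w \<noteq> 0" by (auto simp: l_def)
  define G where "G = (\<Prod>z\<in>?A. l z)"
  have G: "homogeneous (card ?A) G"
    unfolding G_def l_def by (rule homogeneous_prod_linear_form)
  show ?thesis
  proof (rule generically_onI[OF G])
    obtain c where "coords (point_of w) = c *s w" using coords_point_of \<open>w \<noteq> 0\<close> by metis
    then show "point_of w \<in> L" using w(1) by (simp add: L mem_dual_line)
    show "\<not> vanishes_at G (point_of w)"
      using w(2) assms(1) vanishes_at_point_of[OF G \<open>w \<noteq> 0\<close>] by (simp add: G_def)
    fix p assume p: "p \<in> L" "\<not> vanishes_at G p"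
    show "p \<notin> Z"
    proof
      assume "p \<in> Z"
      then have "p \<in> ?A" using p(1) by blast
      moreover have "eval3 (l p) (coords p) = 0" by (simp add: l_def)
      ultimately have "eval3 G (coords p) = 0"
        unfolding G_def eval3_prod using assms(1) by (intro prod_zero) auto
      then show False using p(2) by (simp add: vanishes_at_def)
    qed
  qed
qed

section \<open>Expected dimension and conclusion\<close>

lemma generically_on_mono:
  assumes "generically_on X P" "\<And>p. P p \<Longrightarrow> Q p"
  shows "generically_on X Q"
  using assms unfolding generically_on_def by blast

text \<open>After subtracting the (j choose 2) conditions of a point of multiplicity j - 1, the
  forms of degree \<open>j\<close> leave an expected dimension 2j + 1.\<close>

lemma choose_2_diff: "(j + 2) choose 2 = (j choose 2) + 2 * j + 1"
  by (induction j) (simp_all add: numeral_2_eq_2)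

lemma h0_ideal_small_collinear:
  assumes "finite Z" "p \<notin> Z" "\<And>q. card (Z \<inter> dual_line q) \<le> r + 1"
    and "r + 2 \<le> j" "j + r + 2 \<le> card Z"
  shows "h0_ideal j (insert p Z) + (j + r + 3) \<le> (j + 2) choose 2"
proof -
  let ?Z = "insert p Z"
  have "j + r + 3 \<le> card ?Z" using assms by simp
  then obtain X where X: "X \<subseteq> ?Z" "card X = j + r + 3" "finite X"
    using obtain_subset_with_card_n by metis
  have "\<exists>g. homogeneous j g \<and> (\<forall>y\<in>X - {x}. vanishes_at g y) \<and> \<not> vanishes_at g x"
    if x: "x \<in> X" for x
  proof (rule separating_form)
    \<comment> \<open>There remain j + r + 2 points, at most 2j because r + 2 is at most j. On a
      line through \<open>x\<close>, adding \<open>p\<close> gives at most r + 2 points and removing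
      \<open>x\<close> leaves at most r + 1.\<close>
    show "card (X - {x}) \<le> 2 * j" using X(2,3) x assms(4) by simp
    fix q assume q: "x \<in> dual_line q"
    have "card ((X - {x}) \<inter> dual_line q) \<le> card (?Z \<inter> dual_line q - {x})"
      using X(1) assms(1) by (intro card_mono) auto
    also have "\<dots> = card (?Z \<inter> dual_line q) - 1"
      using q x X(1) assms(1) by (intro card_Diff_singleton) auto
    finally have "card ((X - {x}) \<inter> dual_line q) \<le> card (?Z \<inter> dual_line q) - 1" .
    moreover have "card (?Z \<inter> dual_line q) \<le> card (insert p (Z \<inter> dual_line q))"
      using assms(1) by (intro card_mono) auto
    moreover have "\<dots> \<le> Suc (card (Z \<inter> dual_line q))"
      using assms(1) by (simp add: card_insert_if)
    ultimately show "card ((X - {x}) \<inter> dual_line q) \<le> j"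
      using assms(3)[of q] assms(4) by linarith
  qed (use X in auto)
  then show ?thesis using h0_ideal_bound[OF X(3,1)] X(2) by metis
qed

theorem proposition5p4:
  fixes Z T L :: "proj_plane set" and d m r :: nat
  assumes "finite Z" and "card Z = d"
    and "m = max_multiplicity (dual_arrangement Z)"
    and "r = mdr (dual_poly Z)"
    and "real m \<le> real r + 3 / 2" and "real r + 3 / 2 < real d / 2"
    and "T \<subseteq> Z" and "card T = m"
    and "is_line L" and "T \<subseteq> L"
  shows "generically_on L (\<lambda>p'. \<forall>j :: nat.
           int r + 1 < int j \<and> int j \<le> int d - int r - 2 \<longrightarrow>
           admits_unexpected_curves (insert p' Z) j)"
proof (rule generically_on_mono[OF generically_on_line_notin[OF assms(1,9)]], intro allI impI)
  fix p' and j :: nat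
  assume p': "p' \<notin> Z" and j: "int r + 1 < int j \<and> int j \<le> int d - int r - 2"
  have "Z \<noteq> {}" using j assms(2) by auto
  \<comment> \<open>Since m and r are integers, m at most r + 3/2 means m at most r + 1. Lines with
    fewer than two points of \<open>Z\<close> satisfy the bound trivially.\<close>
  have collinear: "card (Z \<inter> dual_line q) \<le> r + 1" for q
    using card_dual_line_le_max_multiplicity[OF assms(1), of q] assms(3,5)
    by (cases "2 \<le> card (Z \<inter> dual_line q)") auto
  have "homogeneous (card Z) (dual_poly Z)"
    unfolding dual_poly_def by (rule homogeneous_prod_linear_form)
  from mdr_relation[OF this, folded assms(4)] obtain \<theta> i where \<theta>: "\<And>i. homogeneous r (\<theta> i)" "\<theta> i \<noteq> 0"
    and rel: "(\<Sum>i\<in>UNIV. \<theta> i * partial i (dual_poly Z)) = 0"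
    by blast
  obtain w where w: "cross (field_at \<theta> w) w \<noteq> 0" "pairing (coords p') w \<noteq> 0"
    using field_not_radial[OF assms(1) rel \<open>Z \<noteq> {}\<close> \<theta>(2) coords_nonzero] by blast
  obtain P q0 c where P: "c \<noteq> 0" "cross P q0 = c *s w" "eval3 (field_curve \<theta> q0) P \<noteq> 0"
    using field_curve_nonzero[OF w(1) \<theta>(1)] .
  obtain G where G: "homogeneous r G" "\<And>q. eval3 G q = eval3 (field_curve \<theta> q) P"
    using field_curve_polynomial_in_centre[where \<theta> = \<theta> and P = P, OF \<theta>(1)] by blast
  \<comment> \<open>As a form in q this is nonzero exactly when the field curve is nonzero at
    \<open>P\<close> and p' is off the line joining \<open>P\<close> and q: the two conditions of
    \<open>h0_ideal_fat_bound\<close> with \<open>v = P\<close>.\<close>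
  let ?G = "G * linear_form (cross (coords p') P)"
  have hom: "homogeneous (r + Suc 0) ?G"
    by (rule homogeneous_mult[OF G(1) homogeneous_linear_form])
  have eval: "eval3 ?G q = eval3 (field_curve \<theta> q) P * pairing (coords p') (cross P q)" for q
    by (simp add: G(2) pairing_cross_rotate)
  then have "eval3 ?G q0 \<noteq> 0" using P w(2) by simp
  moreover from this have "q0 \<noteq> 0" by auto
  ultimately have q0: "\<not> vanishes_at ?G (point_of q0)"
    using vanishes_at_point_of[OF hom] by simp
  \<comment> \<open>The subtraction is exact because j is at least r + 2.\<close>
  define k where "k = j - r - 2"
  have k: "r + k + 2 = j" "r + k + 1 = j - 1" using j by (auto simp: k_def)
  have "h0_ideal j (insert p' Z) + (j + r + 3) \<le> (j + 2) choose 2"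
    using j assms(2) by (intro h0_ideal_small_collinear[OF assms(1) p' collinear]) auto
  \<comment> \<open>Here 2j + 1 - (j + r + 3) = j - r - 2 = k, whereas the fat point space has
    dimension at least k + 1. As k is a natural number, this also beats the 0 in the
    maximum.\<close>
  then have upper: "int (h0_ideal j (insert p' Z)) - int (j choose 2) \<le> int k"
    unfolding choose_2_diff using k by linarith
  have "generically_on UNIV (\<lambda>q. int (h0_ideal_fat j (insert p' Z) (j - 1) q)
      > max 0 (int (h0_ideal j (insert p' Z)) - int (j choose 2)))"
  proof (rule generically_onI[OF hom UNIV_I q0])
    fix q assume "\<not> vanishes_at ?G q"
    then have "eval3 ?G (coords q) \<noteq> 0" by (simp add: vanishes_at_def)
    then have "k < h0_ideal_fat (r + k + 2) (insert p' Z) (r + k + 1) q"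
      unfolding eval
      by (intro h0_ideal_fat_bound[where \<theta> = \<theta>, OF assms(1) \<theta>(1) field_tangent[OF assms(1) rel]]) auto
    then show "int (h0_ideal_fat j (insert p' Z) (j - 1) q)
        > max 0 (int (h0_ideal j (insert p' Z)) - int (j choose 2))"
      using upper unfolding k by linarith
  qed
  then show "admits_unexpected_curves (insert p' Z) j"
    using j by (simp add: admits_unexpected_curves_def)
qed

end
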